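(* Let $G$ be an accessible graph and let $v$ be a cut vertex of $G$ such that $J_{G\setminus\{v\}}$ is unmixed. Then $G\setminus\{v\}$, $G_v$ and $G_v\setminus\{v\}$ are accessible.
   Context: All graphs are finite and simple. For $S\subseteq V(G)$, $G\setminus S$ is the induced subgraph on $V(G)\setminus S$, and $c_G(S)$ is the number of connected components of $G\setminus S$. A vertex $v$ is a cut vertex of $G$ if $G\setminus\{v\}$ has more connected components than $G$. A set $S\subseteq V(G)$ is a cut set of $G$ if $S=\emptyset$ or $c_G(S\setminus\{s\})<c_G(S)$ for every $s\in S$; $\mathcal C(G)$ is the collection of cut sets of $G$. Let $K$ be a field. The binomial edge ideal of a graph $G$ on $[n]=\{1,\dots,n\}$ is $J_G=(x_iy_j-x_jy_i : \{i,j\}\in E(G))\subseteq K[x_1,\dots,x_n,y_1,\dots,y_n]$ (and similarly for any finite vertex set, with one pair of variables per vertex). $J_G$ is unmixed if all its minimal primes have the same height; equivalently (a known fact), $c_G(S)=|S|+c$ for every $S\in\mathcal C(G)$, where $c$ is the number of connected components of $G$. A graph $G$ is accessible if $J_G$ is unmixed and $\mathcal C(G)$ is an accessible set system, i.e. for every non-empty $S\in\mathcal C(G)$ there exists $s\in S$ such that $S\setminus\{s\}\in\mathcal C(G)$. For a vertex $v$ of $G$, $N_G(v)$ is its set of neighbours, and $G_v$ is the graph with $V(G_v)=V(G)$ and $E(G_v)=E(G)\cup\{\{u,w\}:u,w\in N_G(v),u\ne w\}$. *)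

theory Defs
  imports
    "HOL-Library.Poly_Mapping"
    "HOL-Library.Extended_Nat"
    "HOL-Algebra.Ideal"
begin

section \<open>Graphs\<close>

record 'a ugraph =
  verts :: "'a set"
  edges :: "'a set set"

definition simple_graph :: "'a ugraph \<Rightarrow> bool" where
  "simple_graph G \<longleftrightarrow>
     finite (verts G) \<and>
     edges G \<subseteq> {{u, w} | u w. u \<in> verts G \<and> w \<in> verts G \<and> u \<noteq> w}"

definition neighbours :: "'a ugraph \<Rightarrow> 'a \<Rightarrow> 'a set" where
  "neighbours G v = {u \<in> verts G. {v, u} \<in> edges G}"

definition delete_verts :: "'a ugraph \<Rightarrow> 'a set \<Rightarrow> 'a ugraph" (infixl \<open>\<setminus>\<setminus>\<close> 65) where
  "G \<setminus>\<setminus> S = \<lparr>verts = verts G - S, edges = {e \<in> edges G. e \<subseteq> verts G - S}\<rparr>"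

text \<open>The graph usually written \<open>G\<^sub>v\<close>.\<close>

definition complete_nbhd :: "'a ugraph \<Rightarrow> 'a \<Rightarrow> 'a ugraph" where
  "complete_nbhd G v =
     \<lparr>verts = verts G,
      edges = edges G \<union>
        {{u, w} | u w. u \<in> neighbours G v \<and> w \<in> neighbours G v \<and> u \<noteq> w}\<rparr>"

definition connected_in :: "'a ugraph \<Rightarrow> ('a \<times> 'a) set" where
  "connected_in G =
     {(u, w). u \<in> verts G \<and> w \<in> verts G \<and> (u, w) \<in> {(a, b). {a, b} \<in> edges G}\<^sup>*}"

definition components :: "'a ugraph \<Rightarrow> 'a set set" where
  "components G = verts G // connected_in G"

text \<open>\<open>num_comp_del G S\<close> is \<open>c\<^sub>G(S)\<close>.\<close>

definition num_comp_del :: "'a ugraph \<Rightarrow> 'a set \<Rightarrow> nat" where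
  "num_comp_del G S = card (components (G \<setminus>\<setminus> S))"

definition cut_vertex :: "'a ugraph \<Rightarrow> 'a \<Rightarrow> bool" where
  "cut_vertex G v \<longleftrightarrow>
     v \<in> verts G \<and> card (components (G \<setminus>\<setminus> {v})) > card (components G)"

definition cut_sets :: "'a ugraph \<Rightarrow> 'a set set" where
  "cut_sets G =
     {S. S \<subseteq> verts G \<and>
         (S = {} \<or> (\<forall>s\<in>S. num_comp_del G (S - {s}) < num_comp_del G S))}"

definition accessible_set_system :: "'a set set \<Rightarrow> bool" where
  "accessible_set_system \<C> \<longleftrightarrow> (\<forall>S\<in>\<C>. S \<noteq> {} \<longrightarrow> (\<exists>s\<in>S. S - {s} \<in> \<C>))"


section \<open>Minimal primes, height and unmixedness\<close>

definition minimal_prime :: "('r, 'm) ring_scheme \<Rightarrow> 'r set \<Rightarrow> 'r set \<Rightarrow> bool" where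
  "minimal_prime R I P \<longleftrightarrow>
     primeideal P R \<and> I \<subseteq> P \<and>
     (\<forall>Q. primeideal Q R \<and> I \<subseteq> Q \<and> Q \<subseteq> P \<longrightarrow> Q = P)"

text \<open>The height of a prime \<open>P\<close> is the supremum of the lengths \<open>n\<close> of the chains
  \<open>C 0 \<subset> C 1 \<subset> \<dots> \<subset> C n = P\<close> of prime ideals.\<close>

definition height :: "('r, 'm) ring_scheme \<Rightarrow> 'r set \<Rightarrow> enat" where
  "height R P =
     Sup {enat n | n. \<exists>C :: nat \<Rightarrow> 'r set.
       (\<forall>i\<le>n. primeideal (C i) R) \<and> (\<forall>i<n. C i \<subset> C (Suc i)) \<and> C n = P}"

definition unmixed :: "('r, 'm) ring_scheme \<Rightarrow> 'r set \<Rightarrow> bool" where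
  "unmixed R I \<longleftrightarrow>
     (\<forall>P Q. minimal_prime R I P \<longrightarrow> minimal_prime R I Q \<longrightarrow> height R P = height R Q)"


section \<open>Binomial edge ideals\<close>

type_synonym ('x, 'k) mpoly = "('x \<Rightarrow>\<^sub>0 nat) \<Rightarrow>\<^sub>0 'k"

text \<open>The polynomial ring over the field \<open>'k\<close> in the variables indexed by the set \<open>X\<close>:
  the operations are those of the type, only the carrier depends on \<open>X\<close>.\<close>

definition polynomial_ring :: "'x set \<Rightarrow> ('x, 'k::field) mpoly ring" where
  "polynomial_ring X =
     \<lparr>carrier = {p. \<forall>m\<in>Poly_Mapping.keys p. Poly_Mapping.keys m \<subseteq> X},
      mult = (*), one = 1, zero = 0, add = (+)\<rparr>"

definition Var :: "'x \<Rightarrow> ('x, 'k::field) mpoly" where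
  "Var i = Poly_Mapping.single (Poly_Mapping.single i 1) 1"

text \<open>The variables \<open>x\<^sub>v\<close> and \<open>y\<^sub>v\<close> are indexed by \<open>Inl v\<close> and \<open>Inr v\<close>.\<close>

definition bei_ring :: "'a ugraph \<Rightarrow> ('a + 'a, 'k::field) mpoly ring" where
  "bei_ring G = polynomial_ring (verts G <+> verts G)"

text \<open>An edge \<open>{i, j}\<close> contributes its binomial once for each ordering of its ends, that
  is, together with its negative.\<close>

definition binomial_edge_ideal :: "'a ugraph \<Rightarrow> ('a + 'a, 'k::field) mpoly set" where
  "binomial_edge_ideal G =
     Idl\<^bsub>bei_ring G\<^esub>
       {Var (Inl i) * Var (Inr j) - Var (Inl j) * Var (Inr i) | i j. {i, j} \<in> edges G}"

text \<open>The \<open>itself\<close> argument fixes the coefficient field.\<close>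

definition bei_unmixed :: "'k::field itself \<Rightarrow> 'a ugraph \<Rightarrow> bool" where
  "bei_unmixed K G \<longleftrightarrow>
     unmixed (bei_ring G :: ('a + 'a, 'k) mpoly ring) (binomial_edge_ideal G)"

definition accessible :: "'k::field itself \<Rightarrow> 'a ugraph \<Rightarrow> bool" where
  "accessible K G \<longleftrightarrow> bei_unmixed K G \<and> accessible_set_system (cut_sets G)"


section \<open>Well-formedness\<close>

lemma simple_graph_delete_verts:
  assumes "simple_graph G"
  shows "simple_graph (G \<setminus>\<setminus> S)"
proof -
  have "\<exists>u w. e = {u, w} \<and> u \<in> verts G - S \<and> w \<in> verts G - S \<and> u \<noteq> w"
    if e: "e \<in> edges G" "e \<subseteq> verts G - S" for e
  proof -
    obtain u w where "e = {u, w}" "u \<noteq> w"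
      using assms e(1) unfolding simple_graph_def by blast
    with e(2) show ?thesis by blast
  qed
  moreover have "finite (verts G - S)"
    using assms unfolding simple_graph_def by simp
  ultimately show ?thesis
    unfolding simple_graph_def delete_verts_def by (simp add: subset_iff)
qed

lemma simple_graph_complete_nbhd:
  assumes "simple_graph G"
  shows "simple_graph (complete_nbhd G v)"
proof -
  have "neighbours G v \<subseteq> verts G"
    unfolding neighbours_def by blast
  then have "{{u, w} | u w. u \<in> neighbours G v \<and> w \<in> neighbours G v \<and> u \<noteq> w}
      \<subseteq> {{u, w} | u w. u \<in> verts G \<and> w \<in> verts G \<and> u \<noteq> w}"
    by blast
  then show ?thesis
    using assms unfolding simple_graph_def complete_nbhd_def by simp
qed

lemma cring_polynomial_ring: "cring (polynomial_ring X :: ('x, 'k::field) mpoly ring)"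
proof -
  have add: "p + q \<in> carrier (polynomial_ring X)"
    if "p \<in> carrier (polynomial_ring X)" "q \<in> carrier (polynomial_ring X)"
    for p q :: "('x, 'k) mpoly"
    using that Poly_Mapping.keys_add[of p q] unfolding polynomial_ring_def by (simp, blast)
  have mult: "p * q \<in> carrier (polynomial_ring X)"
    if p: "p \<in> carrier (polynomial_ring X)" and q: "q \<in> carrier (polynomial_ring X)"
    for p q :: "('x, 'k) mpoly"
  proof -
    have "Poly_Mapping.keys m \<subseteq> X" if m: "m \<in> Poly_Mapping.keys (p * q)" for m
    proof -
      obtain a b where ab: "a \<in> Poly_Mapping.keys p" "b \<in> Poly_Mapping.keys q" "m = a + b"
        using m keys_mult[of p q] by blast
      have "Poly_Mapping.keys m \<subseteq> Poly_Mapping.keys a \<union> Poly_Mapping.keys b"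
        unfolding ab(3) by (rule Poly_Mapping.keys_add)
      then show ?thesis
        using ab p q unfolding polynomial_ring_def by auto
    qed
    then show ?thesis unfolding polynomial_ring_def by auto
  qed
  have uminus: "- p \<in> carrier (polynomial_ring X)" if "p \<in> carrier (polynomial_ring X)"
    for p :: "('x, 'k) mpoly"
    using that unfolding polynomial_ring_def by simp
  have one: "1 \<in> carrier (polynomial_ring X :: ('x, 'k) mpoly ring)"
    unfolding polynomial_ring_def by simp
  have zero: "0 \<in> carrier (polynomial_ring X :: ('x, 'k) mpoly ring)"
    unfolding polynomial_ring_def by simp
  note ops = polynomial_ring_def monoid.simps partial_object.simps ring.simps
  have "abelian_group (polynomial_ring X :: ('x, 'k) mpoly ring)"
  proof (rule abelian_groupI)
    show "\<exists>q\<in>carrier (polynomial_ring X). q \<oplus>\<^bsub>polynomial_ring X\<^esub> p = \<zero>\<^bsub>polynomial_ring X\<^esub>"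
      if p: "p \<in> carrier (polynomial_ring X)" for p :: "('x, 'k) mpoly"
    proof (rule bexI)
      show "(- p) \<oplus>\<^bsub>polynomial_ring X\<^esub> p = \<zero>\<^bsub>polynomial_ring X\<^esub>"
        unfolding ops by (rule left_minus)
    qed (rule uminus[OF p])
  next
    show "p \<oplus>\<^bsub>polynomial_ring X\<^esub> q \<in> carrier (polynomial_ring X)"
      if "p \<in> carrier (polynomial_ring X)" "q \<in> carrier (polynomial_ring X)"
      for p q :: "('x, 'k) mpoly"
      using add[OF that] unfolding ops .
  next
    show "\<zero>\<^bsub>polynomial_ring X\<^esub> \<in> carrier (polynomial_ring X :: ('x, 'k) mpoly ring)"
      using zero unfolding ops .
  qed (unfold ops, rule add.assoc add.commute add_0_left, (rule add.assoc add.commute add_0_left)+)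
  moreover have "Group.comm_monoid (polynomial_ring X :: ('x, 'k) mpoly ring)"
  proof (rule comm_monoidI)
    show "p \<otimes>\<^bsub>polynomial_ring X\<^esub> q \<in> carrier (polynomial_ring X)"
      if "p \<in> carrier (polynomial_ring X)" "q \<in> carrier (polynomial_ring X)"
      for p q :: "('x, 'k) mpoly"
      using mult[OF that] unfolding ops .
  next
    show "\<one>\<^bsub>polynomial_ring X\<^esub> \<in> carrier (polynomial_ring X :: ('x, 'k) mpoly ring)"
      using one unfolding ops .
  qed (unfold ops, rule mult.assoc mult.commute mult_1_left, (rule mult.assoc mult.commute mult_1_left)+)
  moreover have "(p \<oplus>\<^bsub>polynomial_ring X\<^esub> q) \<otimes>\<^bsub>polynomial_ring X\<^esub> r =
      p \<otimes>\<^bsub>polynomial_ring X\<^esub> r \<oplus>\<^bsub>polynomial_ring X\<^esub> q \<otimes>\<^bsub>polynomial_ring X\<^esub> r"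
    for p q r :: "('x, 'k) mpoly"
    unfolding ops by (rule distrib_right)
  ultimately show ?thesis
    by (rule cringI)
qed

end

theory Submission
  imports Defs "HOL-Library.Countable_Set"
begin

text \<open>Both conditions in the definition of accessibility are turned into statements about the numbers
  \<open>c\<^sub>G(S)\<close>, and the theorem is then a comparison of the cut sets of the four graphs.

  On the algebraic side, \<open>J\<^sub>G\<close> is unmixed iff \<open>c\<^sub>G(S) = |S| + c\<close> for all cut sets \<open>S\<close>, where \<open>c\<close> is the number of
  components of \<open>G\<close> (\<open>bei_unmixed_iff_comb_unmixed\<close>). Let \<open>P\<^sub>S(G)\<close> be generated by the variables of the
  vertices in \<open>S\<close> and by the minors \<open>x\<^sub>i y\<^sub>j - x\<^sub>j y\<^sub>i\<close> with \<open>i\<close> and \<open>j\<close> in the same component of \<open>G \<setminus> S\<close>. It is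
  the kernel of a monomial map into a domain (\<open>toric_kernel_subset\<close>), hence prime. A prime containing
  \<open>J\<^sub>G\<close> contains \<open>P\<^sub>T(G)\<close> for the set \<open>T\<close> of vertices both of whose variables it contains, and so the
  minimal primes are the \<open>P\<^sub>S(G)\<close> with \<open>S\<close> a cut set (\<open>minimal_prime_binomial_edge_ideal_iff\<close>). The
  height of \<open>P\<^sub>S(G)\<close> is \<open>n + |S| - c\<^sub>G(S)\<close> (\<open>height_cut_prime\<close>): an explicit chain of toric primes has this
  length, and no chain is longer, because every strict inclusion of primes costs one algebraically
  independent element (\<open>independent_mod_Suc\<close>) and there are at most as many of these as variables
  (\<open>independent_mod_le_card\<close>).

  On the combinatorial side, in an unmixed graph \<open>c\<^sub>G(S) \<le> |S| + c\<close> holds for every set \<open>S\<close> of vertices, and the cut sets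
  are the sets where equality holds (\<open>num_comp_del_le\<close>, \<open>cut_set_if_num_comp_del_ge\<close>). Together with the
  unmixedness of \<open>G - v\<close> this gives the cut sets of the other graphs in terms of those of \<open>G\<close>:

  \<^item> \<open>T\<close> is a cut set of \<open>G - v\<close> iff \<open>T \<union> {v}\<close> is a cut set of \<open>G\<close>;
  \<^item> the cut sets of \<open>G\<^sub>v\<close> are those of \<open>G\<close> that avoid \<open>v\<close>;
  \<^item> the cut sets of \<open>G\<^sub>v - v\<close> are those of \<open>G\<close> that avoid \<open>v\<close> and do not contain all of \<open>N(v)\<close>.

  The numbers of components agree accordingly. The last two families are closed under passing to smaller
  cut sets of \<open>G\<close>, so they inherit accessibility. For \<open>G - v\<close> the point is that \<open>v\<close> has neighbours outside
  \<open>T\<close> in two components of \<open>G - v\<close>, for each cut set \<open>T\<close> of \<open>G - v\<close> (\<open>cut_vertex_neighbours_separated\<close>).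
  Hence adding \<open>v\<close> to a subset of \<open>T\<close> always creates a new component, and when a cut set \<open>T - {t}\<close> of
  \<open>G\<close> is available, \<open>(T - {t}) \<union> {v}\<close> is one as well (\<open>accessible_delete_cut_vertex\<close>).\<close>

section \<open>Connectivity and deletion of vertices\<close>

lemma verts_delete_verts [simp]: "verts (G \<setminus>\<setminus> S) = verts G - S"
  by (simp add: delete_verts_def)

lemma edge_delete_verts_iff [simp]:
  "{a, b} \<in> edges (G \<setminus>\<setminus> S) \<longleftrightarrow> {a, b} \<in> edges G \<and> a \<in> verts G - S \<and> b \<in> verts G - S"
  by (auto simp: delete_verts_def)

lemma delete_verts_delete_verts: "G \<setminus>\<setminus> S \<setminus>\<setminus> T = G \<setminus>\<setminus> (S \<union> T)"
  by (auto simp: delete_verts_def)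

lemma delete_verts_empty:
  assumes "simple_graph G"
  shows "G \<setminus>\<setminus> {} = G"
proof -
  have "edges G \<subseteq> Pow (verts G)"
    using assms by (auto simp: simple_graph_def)
  then show ?thesis
    by (cases G) (auto simp: delete_verts_def)
qed

lemma simple_graph_finite: "simple_graph G \<Longrightarrow> finite (verts G)"
  by (simp add: simple_graph_def)

lemma simple_graph_edgeD:
  assumes "simple_graph G" "{a, b} \<in> edges G"
  shows "a \<in> verts G" "b \<in> verts G" "a \<noteq> b"
proof -
  obtain u w where "{a, b} = {u, w}" "u \<in> verts G" "w \<in> verts G" "u \<noteq> w"
    using assms unfolding simple_graph_def by blast
  then show "a \<in> verts G" "b \<in> verts G" "a \<noteq> b"
    by (auto simp: doubleton_eq_iff)
qed

lemma connected_in_verts: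
  assumes "(a, b) \<in> connected_in G"
  shows "a \<in> verts G" "b \<in> verts G"
  using assms by (auto simp: connected_in_def)

lemma connected_in_refl: "a \<in> verts G \<Longrightarrow> (a, a) \<in> connected_in G"
  by (simp add: connected_in_def)

lemma connected_in_trans:
  "(a, b) \<in> connected_in G \<Longrightarrow> (b, c) \<in> connected_in G \<Longrightarrow> (a, c) \<in> connected_in G"
  unfolding connected_in_def by auto

lemma connected_in_sym: "(a, b) \<in> connected_in G \<Longrightarrow> (b, a) \<in> connected_in G"
proof -
  have "sym ({(a, b). {a, b} \<in> edges G}\<^sup>*)"
    by (rule sym_rtrancl) (simp add: sym_def insert_commute)
  then show "(a, b) \<in> connected_in G \<Longrightarrow> (b, a) \<in> connected_in G"
    by (auto simp: connected_in_def dest: symD)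
qed

lemma connected_in_edge:
  "\<lbrakk>{a, b} \<in> edges G; a \<in> verts G; b \<in> verts G\<rbrakk> \<Longrightarrow> (a, b) \<in> connected_in G"
  by (auto simp: connected_in_def)

lemma connected_in_induct [consumes 1, case_names refl edge]:
  assumes "(a, b) \<in> connected_in G"
    and "P a"
    and "\<And>x y. P x \<Longrightarrow> {x, y} \<in> edges G \<Longrightarrow> P y"
  shows "P b"
proof -
  have "(a, b) \<in> {(a, b). {a, b} \<in> edges G}\<^sup>*"
    using assms(1) by (simp add: connected_in_def)
  then show ?thesis
    by (induction rule: rtrancl_induct) (use assms(2,3) in auto)
qed

lemma connected_in_delete_mono:
  assumes "T \<subseteq> S"
  shows "connected_in (G \<setminus>\<setminus> S) \<subseteq> connected_in (G \<setminus>\<setminus> T)"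
proof clarify
  fix a b assume ab: "(a, b) \<in> connected_in (G \<setminus>\<setminus> S)"
  have "{(a, b). {a, b} \<in> edges (G \<setminus>\<setminus> S)} \<subseteq> {(a, b). {a, b} \<in> edges (G \<setminus>\<setminus> T)}"
    using assms by auto
  from rtrancl_mono[OF this] show "(a, b) \<in> connected_in (G \<setminus>\<setminus> T)"
    using ab assms unfolding connected_in_def by auto
qed

lemma equiv_connected_in: "equiv (verts G) (connected_in G)"
proof (rule equivI)
  show "connected_in G \<subseteq> verts G \<times> verts G"
    by (auto simp: connected_in_def)
  show "refl_on (verts G) (connected_in G)"
    by (auto simp: refl_on_def intro: connected_in_refl)
  show "sym (connected_in G)"
    by (rule symI) (rule connected_in_sym)
  show "trans (connected_in G)"
    by (rule transI) (rule connected_in_trans)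
qed

lemma finite_components: "finite (verts G) \<Longrightarrow> finite (components G)"
  unfolding components_def
  by (rule finite_quotient) (auto simp: connected_in_def)

lemma connected_in_eqI:
  assumes "verts G = verts H"
    and "\<And>a b. {a, b} \<in> edges G \<Longrightarrow> (a, b) \<in> connected_in H"
    and "\<And>a b. {a, b} \<in> edges H \<Longrightarrow> (a, b) \<in> connected_in G"
  shows "connected_in G = connected_in H"
proof -
  have "connected_in G \<subseteq> connected_in H"
    if "verts G = verts H" "\<And>a b. {a, b} \<in> edges G \<Longrightarrow> (a, b) \<in> connected_in H"
    for G H :: "'b ugraph"
  proof clarify
    fix a b assume ab: "(a, b) \<in> connected_in G"
    then show "(a, b) \<in> connected_in H"
    proof (induction rule: connected_in_induct)
      case refl
      show ?case using connected_in_verts(1)[OF ab] that(1) by (simp add: connected_in_refl)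
    next
      case (edge x y)
      show ?case by (rule connected_in_trans[OF edge.IH that(2)[OF edge.hyps]])
    qed
  qed
  then show ?thesis using assms by (metis subset_antisym)
qed

section \<open>Components after the deletion of one vertex\<close>

lemma neighboursD:
  assumes "simple_graph G" "a \<in> neighbours G s"
  shows "a \<in> verts G" "{s, a} \<in> edges G" "a \<noteq> s"
  using assms simple_graph_edgeD(3)[of G s a] by (auto simp: neighbours_def)

text \<open>A walk that passes through \<open>s\<close> enters and leaves it through neighbours of \<open>s\<close>, so it can be
  rerouted around \<open>s\<close> once these are connected to each other without \<open>s\<close>.\<close>

lemma connected_in_delete_if_neighbours_connected:
  assumes G: "simple_graph G"
    and N: "\<And>a b. \<lbrakk>a \<in> neighbours G s; b \<in> neighbours G s\<rbrakk> \<Longrightarrow> (a, b) \<in> connected_in (G \<setminus>\<setminus> {s})"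
    and xy: "(x, y) \<in> connected_in G" "x \<noteq> s" "y \<noteq> s"
  shows "(x, y) \<in> connected_in (G \<setminus>\<setminus> {s})"
proof -
  have x: "x \<in> verts G"
    using connected_in_verts[OF xy(1)] by simp
  \<comment> \<open>The walk may stop at \<open>s\<close> halfway; then every way out of \<open>s\<close> is reachable without \<open>s\<close>.\<close>
  have "if y = s then \<forall>b\<in>neighbours G s. (x, b) \<in> connected_in (G \<setminus>\<setminus> {s})
        else (x, y) \<in> connected_in (G \<setminus>\<setminus> {s})"
    using xy(1)
  proof (induction rule: connected_in_induct)
    case refl
    show ?case using x xy(2) by (simp add: connected_in_refl)
  next
    case (edge y z)
    note e = simple_graph_edgeD[OF G edge.hyps]
    consider "y \<noteq> s" "z \<noteq> s" | "y \<noteq> s" "z = s" | "y = s" "z \<noteq> s"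
      using e by auto
    then show ?case
    proof cases
      case 1
      then have "(y, z) \<in> connected_in (G \<setminus>\<setminus> {s})"
        using edge.hyps e by (intro connected_in_edge) auto
      then show ?thesis using 1 edge.IH connected_in_trans by auto
    next
      case 2
      then have "y \<in> neighbours G s"
        using e edge.hyps by (simp add: neighbours_def insert_commute)
      then show ?thesis using 2 edge.IH connected_in_trans[OF _ N] by simp
    next
      case 3
      then have "z \<in> neighbours G s"
        using e edge.hyps by (simp add: neighbours_def)
      then show ?thesis using 3 edge.IH by auto
    qed
  qed
  then show ?thesis using xy(3) by simp
qed

text \<open>The components of \<open>G\<close> are counted through the map that sends a component of \<open>G - s\<close>
  to the component of \<open>G\<close> around it. It is onto unless \<open>s\<close> is isolated, and the classes that
  it identifies are those that contain neighbours of \<open>s\<close>.\<close>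

lemma
  assumes G: "simple_graph G" and s: "s \<in> verts G"
  shows card_components_delete_le:
      "(\<And>a b. \<lbrakk>a \<in> neighbours G s; b \<in> neighbours G s\<rbrakk> \<Longrightarrow> (a, b) \<in> connected_in (G \<setminus>\<setminus> {s}))
       \<Longrightarrow> card (components (G \<setminus>\<setminus> {s})) \<le> card (components G)"
    and card_components_delete_ge:
      "neighbours G s \<noteq> {} \<Longrightarrow> card (components G) \<le> card (components (G \<setminus>\<setminus> {s}))"
    and card_components_delete_gt:
      "\<lbrakk>a \<in> neighbours G s; b \<in> neighbours G s; (a, b) \<notin> connected_in (G \<setminus>\<setminus> {s})\<rbrakk>
       \<Longrightarrow> card (components G) < card (components (G \<setminus>\<setminus> {s}))"
proof -
  let ?H = "G \<setminus>\<setminus> {s}"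
  let ?q = "\<lambda>C. connected_in G `` C"
  have fin: "finite (components G)" "finite (components ?H)"
    using simple_graph_finite[OF G] by (auto intro: finite_components)
  have sub: "connected_in ?H \<subseteq> connected_in G"
    using connected_in_delete_mono[of "{}" "{s}" G] delete_verts_empty[OF G] by simp
  have q: "?q (connected_in ?H `` {x}) = connected_in G `` {x}" if "x \<in> verts ?H" for x
    using sub connected_in_refl[OF that] connected_in_trans[of _ _ G] by blast
  have q_in: "?q ` components ?H \<subseteq> components G"
  proof clarify
    fix C assume "C \<in> components ?H"
    then obtain x where "x \<in> verts ?H" "C = connected_in ?H `` {x}"
      unfolding components_def quotient_def by blast
    then show "?q C \<in> components G"
      using q unfolding components_def quotient_def by auto
  qed
  have nbr: "a \<in> verts ?H" "(s, a) \<in> connected_in G" if "a \<in> neighbours G s" for a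
    using neighboursD[OF G that] s by (auto intro: connected_in_edge)
  have onto: "components G \<subseteq> ?q ` components ?H" if "neighbours G s \<noteq> {}"
  proof
    fix C assume "C \<in> components G"
    then obtain x where x: "x \<in> verts G" "C = connected_in G `` {x}"
      unfolding components_def quotient_def by blast
    obtain a where a: "a \<in> neighbours G s" using \<open>neighbours G s \<noteq> {}\<close> by blast
    have "\<exists>y\<in>verts ?H. C = connected_in G `` {y}"
    proof (cases "x = s")
      case True
      then have "C = connected_in G `` {a}"
        using x(2) equiv_class_eq[OF equiv_connected_in nbr(2)[OF a]] by simp
      then show ?thesis using nbr(1)[OF a] by blast
    next
      case False
      then show ?thesis using x by auto
    qed
    then obtain y where y: "y \<in> verts ?H" "C = connected_in G `` {y}" by blast
    show "C \<in> ?q ` components ?H"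
    proof (rule image_eqI)
      show "C = ?q (connected_in ?H `` {y})"
        using q[OF y(1)] y(2) by simp
      show "connected_in ?H `` {y} \<in> components ?H"
        unfolding components_def using y(1) by (rule quotientI)
    qed
  qed
  show "card (components ?H) \<le> card (components G)"
    if N: "\<And>a b. \<lbrakk>a \<in> neighbours G s; b \<in> neighbours G s\<rbrakk> \<Longrightarrow> (a, b) \<in> connected_in ?H"
  proof (rule card_inj_on_le[OF _ q_in fin(1)], rule inj_onI)
    fix C D assume CD: "C \<in> components ?H" "D \<in> components ?H" "?q C = ?q D"
    then obtain x y where x: "x \<in> verts ?H" "C = connected_in ?H `` {x}"
      and y: "y \<in> verts ?H" "D = connected_in ?H `` {y}"
      unfolding components_def quotient_def by blast
    have "connected_in G `` {x} = connected_in G `` {y}"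
      using CD(3) q x y by simp
    then have "(x, y) \<in> connected_in G"
      using y(1) eq_equiv_class[OF _ equiv_connected_in] by fastforce
    then have "(x, y) \<in> connected_in ?H"
      using connected_in_delete_if_neighbours_connected[OF G N] x(1) y(1) by simp
    then show "C = D"
      using x y equiv_class_eq[OF equiv_connected_in] by simp
  qed
  show ge: "card (components G) \<le> card (components ?H)" if "neighbours G s \<noteq> {}"
    using surj_card_le[OF fin(2) onto[OF that]] .
  show "card (components G) < card (components ?H)"
    if ab: "a \<in> neighbours G s" "b \<in> neighbours G s" "(a, b) \<notin> connected_in ?H"
  proof (rule ccontr)
    let ?C = "\<lambda>a. connected_in ?H `` {a}"
    assume "\<not> ?thesis"
    then have "card (components G) = card (components ?H)"
      using ge ab(1) by fastforce
    moreover have "?q ` components ?H = components G"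
      using onto q_in ab(1) by blast
    ultimately have inj: "inj_on ?q (components ?H)"
      using fin(2) by (simp add: eq_card_imp_inj_on)
    have "(a, b) \<in> connected_in G"
      by (rule connected_in_trans[OF connected_in_sym[OF nbr(2)[OF ab(1)]] nbr(2)[OF ab(2)]])
    then have "?q (?C a) = ?q (?C b)"
      using q nbr(1) ab equiv_class_eq[OF equiv_connected_in] by metis
    moreover have "?C a \<in> components ?H" "?C b \<in> components ?H"
      using nbr(1) ab unfolding components_def by (auto intro: quotientI)
    ultimately have "?C a = ?C b"
      by (rule inj_onD[OF inj])
    from eq_equiv_class[OF this equiv_connected_in nbr(1)[OF ab(2)]] show False
      using ab(3) by contradiction
  qed
qed

section \<open>Cut sets\<close>

lemma neighbours_delete_verts:
  assumes "simple_graph G" "s \<in> verts G" "s \<notin> S"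
  shows "neighbours (G \<setminus>\<setminus> S) s = neighbours G s - S"
  using assms by (auto simp: neighbours_def)

lemma num_comp_del_insert_gt_iff:
  assumes G: "simple_graph G" and s: "s \<in> verts G" "s \<notin> S"
  shows "num_comp_del G S < num_comp_del G (insert s S) \<longleftrightarrow>
    (\<exists>a\<in>neighbours G s - S. \<exists>b\<in>neighbours G s - S. (a, b) \<notin> connected_in (G \<setminus>\<setminus> insert s S))"
proof -
  have eq: "G \<setminus>\<setminus> S \<setminus>\<setminus> {s} = G \<setminus>\<setminus> insert s S"
    by (simp add: delete_verts_delete_verts)
  have GS: "simple_graph (G \<setminus>\<setminus> S)" "s \<in> verts (G \<setminus>\<setminus> S)"
    using simple_graph_delete_verts[OF G] s by auto
  show ?thesis
    using card_components_delete_le[OF GS] card_components_delete_gt[OF GS]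
    unfolding neighbours_delete_verts[OF G s] eq num_comp_del_def
    by (meson linorder_not_less)
qed

lemma num_comp_del_insert_eq:
  assumes G: "simple_graph G" and s: "s \<in> verts G" "s \<notin> S"
    and ne: "neighbours G s - S \<noteq> {}"
    and N: "\<And>a b. \<lbrakk>a \<in> neighbours G s - S; b \<in> neighbours G s - S\<rbrakk>
      \<Longrightarrow> (a, b) \<in> connected_in (G \<setminus>\<setminus> insert s S)"
  shows "num_comp_del G (insert s S) = num_comp_del G S"
proof -
  have eq: "G \<setminus>\<setminus> S \<setminus>\<setminus> {s} = G \<setminus>\<setminus> insert s S"
    by (simp add: delete_verts_delete_verts)
  have GS: "simple_graph (G \<setminus>\<setminus> S)" "s \<in> verts (G \<setminus>\<setminus> S)"
    using simple_graph_delete_verts[OF G] s by auto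
  show ?thesis
    using card_components_delete_le[OF GS] card_components_delete_ge[OF GS] ne N
    unfolding neighbours_delete_verts[OF G s] eq num_comp_del_def
    by (intro le_antisym) blast+
qed

lemma cut_sets_iff:
  "S \<in> cut_sets G \<longleftrightarrow>
    S \<subseteq> verts G \<and> (\<forall>s\<in>S. num_comp_del G (S - {s}) < num_comp_del G S)"
  by (auto simp: cut_sets_def)

lemma empty_in_cut_sets: "{} \<in> cut_sets G"
  by (simp add: cut_sets_def)

text \<open>Putting \<open>s\<close> back lowers the number of components exactly if \<open>s\<close> touches two of them. In this
  form membership in \<open>\<C>(G)\<close> can be checked locally, without counting.\<close>

lemma cut_sets_iff_separates_neighbours:
  assumes G: "simple_graph G"
  shows "S \<in> cut_sets G \<longleftrightarrow> S \<subseteq> verts G \<and>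
    (\<forall>s\<in>S. \<exists>a\<in>neighbours G s - S. \<exists>b\<in>neighbours G s - S. (a, b) \<notin> connected_in (G \<setminus>\<setminus> S))"
proof -
  have "num_comp_del G (S - {s}) < num_comp_del G S \<longleftrightarrow>
    (\<exists>a\<in>neighbours G s - S. \<exists>b\<in>neighbours G s - S. (a, b) \<notin> connected_in (G \<setminus>\<setminus> S))"
    if "S \<subseteq> verts G" "s \<in> S" for s
  proof -
    have "neighbours G s - (S - {s}) = neighbours G s - S"
      using neighboursD(3)[OF G] by blast
    then show ?thesis
      using num_comp_del_insert_gt_iff[OF G, of s "S - {s}"] that by (auto simp: insert_absorb)
  qed
  then show ?thesis
    unfolding cut_sets_iff by blast
qed

text \<open>The combinatorial side of unmixedness; \<open>num_comp_del G {}\<close> is the number of components of \<open>G\<close>.\<close>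

definition comb_unmixed :: "'a ugraph \<Rightarrow> bool" where
  "comb_unmixed G \<longleftrightarrow> (\<forall>S\<in>cut_sets G. num_comp_del G S = card S + num_comp_del G {})"

text \<open>Removing from \<open>S\<close>, one after the other, vertices that do not lower the number of
  components ends in a cut set, and only makes \<open>c\<^sub>G(S) - |S|\<close> larger.\<close>

lemma num_comp_del_le:
  assumes G: "simple_graph G" and U: "comb_unmixed G" and S: "S \<subseteq> verts G"
  shows "num_comp_del G S \<le> card S + num_comp_del G {}"
  using S
proof (induction "card S" arbitrary: S rule: less_induct)
  case less
  have fin: "finite S"
    using less.prems simple_graph_finite[OF G] finite_subset by blast
  show ?case
  proof (cases "S \<in> cut_sets G")
    case True
    then show ?thesis using U by (simp add: comb_unmixed_def)
  next
    case False
    then obtain s where s: "s \<in> S" "num_comp_del G S \<le> num_comp_del G (S - {s})"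
      using less.prems unfolding cut_sets_iff by (auto simp: not_less)
    have "card (S - {s}) < card S"
      using fin s(1) by (rule card_Diff1_less)
    then show ?thesis
      using less.hyps[of "S - {s}"] less.prems s by fastforce
  qed
qed

text \<open>In an unmixed graph the cut sets are thus the sets where \<open>c\<^sub>G(S) - |S|\<close> is maximal.\<close>

lemma cut_set_if_num_comp_del_ge:
  assumes G: "simple_graph G" and U: "comb_unmixed G" and S: "S \<subseteq> verts G"
    and ge: "card S + num_comp_del G {} \<le> num_comp_del G S"
  shows "S \<in> cut_sets G"
  unfolding cut_sets_iff
proof (intro conjI ballI)
  fix s assume s: "s \<in> S"
  have "finite S" using S simple_graph_finite[OF G] finite_subset by blast
  then have "card (S - {s}) < card S" using s by (rule card_Diff1_less)
  moreover have "num_comp_del G (S - {s}) \<le> card (S - {s}) + num_comp_del G {}"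
    using num_comp_del_le[OF G U] S by blast
  ultimately show "num_comp_del G (S - {s}) < num_comp_del G S"
    using ge by linarith
qed (rule S)

lemma accessible_set_systemD:
  assumes "accessible_set_system \<C>" "S \<in> \<C>" "S \<noteq> {}"
  obtains s where "s \<in> S" "S - {s} \<in> \<C>"
  using assms by (auto simp: accessible_set_system_def)

text \<open>Accessibility only asks for smaller members, so it passes to subsystems that are closed
  under taking smaller members.\<close>

lemma accessible_set_system_subsystem:
  assumes A: "accessible_set_system \<C>" and P: "\<And>S T. P S \<Longrightarrow> T \<subseteq> S \<Longrightarrow> P T"
  shows "accessible_set_system {S \<in> \<C>. P S}"
  unfolding accessible_set_system_def
proof (intro ballI impI)
  fix S assume S: "S \<in> {S \<in> \<C>. P S}" "S \<noteq> {}"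
  from S(1) have "S \<in> \<C>" by simp
  from accessible_set_systemD[OF A this S(2)]
  obtain s where s: "s \<in> S" "S - {s} \<in> \<C>" .
  have "P (S - {s})" using S(1) P[of S "S - {s}"] by auto
  then show "\<exists>s\<in>S. S - {s} \<in> {S \<in> \<C>. P S}" using s by auto
qed

section \<open>Deleting a cut vertex\<close>

context
  fixes G :: "'a ugraph" and v :: 'a
  assumes G: "simple_graph G"
    and U: "comb_unmixed G"
    and cut: "cut_vertex G v"
    and U_del: "comb_unmixed (G \<setminus>\<setminus> {v})"
begin

lemma cut_vertex_in_verts: "v \<in> verts G"
  using cut by (simp add: cut_vertex_def)

lemma num_comp_del_delete_vertex: "num_comp_del (G \<setminus>\<setminus> {v}) S = num_comp_del G (insert v S)"
  by (simp add: num_comp_del_def delete_verts_delete_verts)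

lemma num_comp_del_cut_vertex: "num_comp_del G {v} = Suc (num_comp_del G {})"
proof -
  have "{v} \<in> cut_sets G"
    using cut cut_vertex_in_verts delete_verts_empty[OF G]
    by (simp add: cut_sets_iff cut_vertex_def num_comp_del_def)
  then show ?thesis
    using U by (simp add: comb_unmixed_def)
qed

text \<open>If \<open>T\<close> is a cut set of \<open>G - v\<close>, then unmixedness of \<open>G - v\<close>, whose number of components is one more
  than that of \<open>G\<close>, gives \<open>T \<union> {v}\<close> the maximal number of components in \<open>G\<close>. This is the step that needs
  both graphs to be unmixed.\<close>

lemma cut_sets_delete_cut_vertex_iff:
  assumes T: "T \<subseteq> verts G - {v}"
  shows "T \<in> cut_sets (G \<setminus>\<setminus> {v}) \<longleftrightarrow> insert v T \<in> cut_sets G"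
proof
  have "finite T" "v \<notin> T"
    using T simple_graph_finite[OF G] finite_subset[of T "verts G"] by auto
  then have card: "card (insert v T) = Suc (card T)" by simp
  assume "T \<in> cut_sets (G \<setminus>\<setminus> {v})"
  then have "num_comp_del G (insert v T) = card T + num_comp_del G {v}"
    using U_del by (simp add: comb_unmixed_def num_comp_del_delete_vertex)
  then have "card (insert v T) + num_comp_del G {} \<le> num_comp_del G (insert v T)"
    using card num_comp_del_cut_vertex by simp
  moreover have "insert v T \<subseteq> verts G"
    using T cut_vertex_in_verts by blast
  ultimately show "insert v T \<in> cut_sets G"
    using cut_set_if_num_comp_del_ge[OF G U] by blast
next
  assume "insert v T \<in> cut_sets G"
  moreover have "insert v (T - {t}) = insert v T - {t}" if "t \<in> T" for t
    using T that by blast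
  ultimately show "T \<in> cut_sets (G \<setminus>\<setminus> {v})"
    using T by (simp add: cut_sets_iff num_comp_del_delete_vertex)
qed

text \<open>Suppose all neighbours of \<open>v\<close> outside \<open>T\<close> lie in one component \<open>C\<close> of \<open>G - v\<close>. Then
  \<open>T - C\<close> is still a cut set of \<open>G - v\<close>, as the vertices of \<open>T\<close> outside \<open>C\<close> separate the same
  neighbours as before. So \<open>(T - C) \<union> {v}\<close> is a cut set of \<open>G\<close>, although \<open>v\<close> only touches \<open>C\<close>,
  which is connected and untouched.\<close>

lemma cut_vertex_neighbours_separated:
  assumes T: "T \<in> cut_sets (G \<setminus>\<setminus> {v})"
  shows "\<exists>a\<in>neighbours G v - T. \<exists>b\<in>neighbours G v - T. (a, b) \<notin> connected_in (G \<setminus>\<setminus> {v})"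
proof (rule ccontr)
  let ?H = "G \<setminus>\<setminus> {v}"
  assume "\<not> ?thesis"
  then have conn: "(a, b) \<in> connected_in ?H"
    if "a \<in> neighbours G v - T" "b \<in> neighbours G v - T" for a b
    using that by blast
  have H: "simple_graph ?H" by (rule simple_graph_delete_verts[OF G])
  have TH: "T \<subseteq> verts G - {v}" using T by (auto simp: cut_sets_def)
  have "insert v T \<in> cut_sets G"
    using cut_sets_delete_cut_vertex_iff[OF TH] T by simp
  then obtain a0 where a0: "a0 \<in> neighbours G v - T"
    unfolding cut_sets_iff_separates_neighbours[OF G] by blast
  have a0H: "a0 \<in> verts ?H"
    using a0 neighboursD[OF G, of a0 v] by simp
  define C where "C = connected_in ?H `` {a0}"
  let ?T = "T - C"
  \<comment> \<open>Deleting \<open>D\<close> does not disturb a component that \<open>D\<close> does not meet.\<close>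
  have path: "(x, y) \<in> connected_in (?H \<setminus>\<setminus> D)"
    if xy: "(x, y) \<in> connected_in ?H" and D: "D \<inter> connected_in ?H `` {x} = {}" for x y D
  proof -
    have x: "x \<in> verts ?H" "x \<notin> D"
      using D connected_in_verts[OF xy] connected_in_refl[of x ?H] by auto
    have "(x, y) \<in> connected_in (?H \<setminus>\<setminus> D) \<and> (x, y) \<in> connected_in ?H"
      using xy
    proof (induction rule: connected_in_induct)
      case refl
      show ?case using x by (auto intro: connected_in_refl)
    next
      case (edge y z)
      note e = simple_graph_edgeD[OF H edge.hyps]
      have "(y, z) \<in> connected_in ?H"
        using e edge.hyps by (blast intro: connected_in_edge)
      then have xz: "(x, z) \<in> connected_in ?H"
        using edge.IH connected_in_trans[of x y ?H z] by blast
      then have "y \<notin> D" "z \<notin> D"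
        using D edge.IH by auto
      then have "(y, z) \<in> connected_in (?H \<setminus>\<setminus> D)"
        using e edge.hyps by (intro connected_in_edge) auto
      then show ?case using xz edge.IH connected_in_trans[of x y "?H \<setminus>\<setminus> D" z] by blast
    qed
    then show ?thesis by simp
  qed
  have "?T \<in> cut_sets ?H"
    unfolding cut_sets_iff_separates_neighbours[OF H]
  proof (intro conjI ballI)
    show "?T \<subseteq> verts ?H" using TH by auto
    fix s assume s: "s \<in> ?T"
    then obtain a b where ab: "a \<in> neighbours ?H s - T" "b \<in> neighbours ?H s - T"
      "(a, b) \<notin> connected_in (?H \<setminus>\<setminus> T)"
      using T unfolding cut_sets_iff_separates_neighbours[OF H] by blast
    have sH: "s \<in> verts ?H" using s TH by auto
    have "(s, a) \<in> connected_in ?H"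
      using neighboursD[OF H, of a s] ab(1) sH by (blast intro: connected_in_edge)
    then have aC: "(a0, a) \<notin> connected_in ?H"
      using s C_def connected_in_sym[of s a ?H] connected_in_trans[of a0 a ?H s] by blast
    have "(a, b) \<notin> connected_in (?H \<setminus>\<setminus> ?T)"
    proof
      assume "(a, b) \<in> connected_in (?H \<setminus>\<setminus> ?T)"
      then have "(a, b) \<in> connected_in (?H \<setminus>\<setminus> T)"
      proof (induction rule: connected_in_induct)
        case refl
        show ?case using ab(1) neighboursD[OF H, of a s] by (auto intro: connected_in_refl)
      next
        case (edge y z)
        have yz: "{y, z} \<in> edges ?H" "y \<in> verts ?H - ?T" "z \<in> verts ?H - ?T"
          using edge.hyps by auto
        have ay: "(a, y) \<in> connected_in ?H"
          using edge.IH connected_in_delete_mono[of "{}" T ?H] delete_verts_empty[OF H] by auto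
        moreover have "(y, z) \<in> connected_in ?H"
          using yz by (blast intro: connected_in_edge)
        ultimately have az: "(a, z) \<in> connected_in ?H"
          by (rule connected_in_trans)
        have "y \<notin> C" "z \<notin> C"
          using aC connected_in_trans[OF _ connected_in_sym[OF ay]]
            connected_in_trans[OF _ connected_in_sym[OF az]] unfolding C_def by blast+
        then have "(y, z) \<in> connected_in (?H \<setminus>\<setminus> T)"
          using yz by (intro connected_in_edge) auto
        then show ?case by (rule connected_in_trans[OF edge.IH])
      qed
      then show False using ab(3) by blast
    qed
    then show "\<exists>a\<in>neighbours ?H s - ?T. \<exists>b\<in>neighbours ?H s - ?T.
        (a, b) \<notin> connected_in (?H \<setminus>\<setminus> ?T)"
      using ab by blast
  qed
  then have "insert v ?T \<in> cut_sets G"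
    using cut_sets_delete_cut_vertex_iff[of ?T] TH by blast
  then obtain a b where ab: "a \<in> neighbours G v - ?T" "b \<in> neighbours G v - ?T"
    "(a, b) \<notin> connected_in (?H \<setminus>\<setminus> ?T)"
    unfolding cut_sets_iff_separates_neighbours[OF G] by (auto simp: delete_verts_delete_verts)
  have C: "(a0, x) \<in> connected_in ?H" if "x \<in> neighbours G v - ?T" for x
    using conn[OF a0, of x] that by (cases "x \<in> T") (auto simp: C_def)
  have "(a, b) \<in> connected_in ?H"
    by (rule connected_in_trans[OF connected_in_sym[OF C[OF ab(1)]] C[OF ab(2)]])
  moreover have "?T \<inter> connected_in ?H `` {a} = {}"
    using connected_in_trans[OF C[OF ab(1)]] unfolding C_def by blast
  ultimately show False
    using path ab(3) by blast
qed

text \<open>Accessibility of \<open>G\<close> allows some vertex to be dropped from the cut set \<open>T \<union> {v}\<close>. The critical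
  case is that this vertex is \<open>v\<close>. Then \<open>T\<close> itself is a cut set of \<open>G\<close>, and so is \<open>T - {t}\<close> for some \<open>t\<close>.
  Deleting \<open>v\<close> as well raises the number of components again, as \<open>v\<close> has neighbours outside \<open>T\<close> in two
  components of \<open>G - v\<close>; so \<open>(T - {t}) \<union> {v}\<close> has the maximal number of components.\<close>

lemma accessible_delete_cut_vertex:
  assumes A: "accessible_set_system (cut_sets G)"
  shows "accessible_set_system (cut_sets (G \<setminus>\<setminus> {v}))"
  unfolding accessible_set_system_def
proof (intro ballI impI)
  let ?H = "G \<setminus>\<setminus> {v}"
  fix T assume T: "T \<in> cut_sets ?H" "T \<noteq> {}"
  have TH: "T \<subseteq> verts G - {v}" using T by (auto simp: cut_sets_def)
  have v: "insert v T \<in> cut_sets G"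
    using cut_sets_delete_cut_vertex_iff[OF TH] T by simp
  from accessible_set_systemD[OF A this insert_not_empty]
  obtain s where s: "s \<in> insert v T" "insert v T - {s} \<in> cut_sets G" .
  have ex: "\<exists>t\<in>T. insert v (T - {t}) \<in> cut_sets G"
  proof (cases "s = v")
    case False
    then have "insert v T - {s} = insert v (T - {s})" by blast
    then show ?thesis using s False by auto
  next
    case True
    then have "insert v T - {s} = T" using TH by blast
    then have "T \<in> cut_sets G" using s(2) by simp
    from accessible_set_systemD[OF A this T(2)]
    obtain t where t: "t \<in> T" "T - {t} \<in> cut_sets G" .
    let ?U = "T - {t}"
    obtain a b where ab: "a \<in> neighbours G v - T" "b \<in> neighbours G v - T"
      "(a, b) \<notin> connected_in ?H"
      using cut_vertex_neighbours_separated[OF T(1)] by blast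
    have "(a, b) \<notin> connected_in (G \<setminus>\<setminus> insert v ?U)"
      using ab(3) connected_in_delete_mono[of "{v}" "insert v ?U" G] by blast
    moreover have vU: "v \<notin> ?U" using TH by blast
    ultimately have "num_comp_del G ?U < num_comp_del G (insert v ?U)"
      using num_comp_del_insert_gt_iff[OF G cut_vertex_in_verts, of ?U] ab(1,2) by blast
    moreover have "num_comp_del G ?U = card ?U + num_comp_del G {}"
      using t(2) U by (simp add: comb_unmixed_def)
    moreover have "finite ?U"
      using TH simple_graph_finite[OF G] finite_subset[of T "verts G"] by blast
    then have "card (insert v ?U) = Suc (card ?U)"
      using vU by (rule card_insert_disjoint)
    ultimately have "card (insert v ?U) + num_comp_del G {} \<le> num_comp_del G (insert v ?U)"
      by simp
    moreover have "insert v ?U \<subseteq> verts G" using TH cut_vertex_in_verts by blast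
    ultimately show ?thesis
      using cut_set_if_num_comp_del_ge[OF G U] t(1) by blast
  qed
  then obtain t where t: "t \<in> T" "insert v (T - {t}) \<in> cut_sets G" by blast
  then have "T - {t} \<in> cut_sets ?H"
    using cut_sets_delete_cut_vertex_iff[of "T - {t}"] TH by blast
  then show "\<exists>t\<in>T. T - {t} \<in> cut_sets ?H" using t(1) by blast
qed

section \<open>Completing the neighbourhood of a cut vertex\<close>

abbreviation (input) "Gv \<equiv> complete_nbhd G v"

lemma verts_complete_nbhd [simp]: "verts Gv = verts G"
  by (simp add: complete_nbhd_def)

lemma edge_complete_nbhd_iff:
  "{a, b} \<in> edges Gv \<longleftrightarrow>
    {a, b} \<in> edges G \<or> (a \<in> neighbours G v \<and> b \<in> neighbours G v \<and> a \<noteq> b)"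
  by (auto simp: complete_nbhd_def doubleton_eq_iff)

lemma simple_complete_nbhd: "simple_graph Gv"
  by (rule simple_graph_complete_nbhd[OF G])

lemma not_own_neighbour: "v \<notin> neighbours G v"
proof
  assume "v \<in> neighbours G v"
  from neighboursD(3)[OF G this] show False by (rule notE) (rule refl)
qed

lemma neighbours_complete_nbhd: "neighbours Gv v = neighbours G v"
proof -
  have "{v, u} \<in> edges Gv \<longleftrightarrow> {v, u} \<in> edges G" for u
    using not_own_neighbour by (simp add: edge_complete_nbhd_iff)
  then show ?thesis
    by (simp add: neighbours_def)
qed

text \<open>While \<open>v\<close> is present its neighbours are connected through it anyway.\<close>

lemma num_comp_del_complete_nbhd:
  assumes "v \<notin> S"
  shows "num_comp_del Gv S = num_comp_del G S"
proof -
  have "connected_in (Gv \<setminus>\<setminus> S) = connected_in (G \<setminus>\<setminus> S)"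
  proof (rule connected_in_eqI)
    fix a b assume e: "{a, b} \<in> edges (Gv \<setminus>\<setminus> S)"
    show "(a, b) \<in> connected_in (G \<setminus>\<setminus> S)"
    proof (cases "{a, b} \<in> edges G")
      case True
      then show ?thesis using e by (intro connected_in_edge) auto
    next
      case False
      have "(v, x) \<in> connected_in (G \<setminus>\<setminus> S)" if "x \<in> neighbours G v" "x \<notin> S" for x
        using neighboursD[OF G that(1)] that(2) assms cut_vertex_in_verts
        by (intro connected_in_edge) auto
      moreover have "a \<in> neighbours G v" "b \<in> neighbours G v" "a \<notin> S" "b \<notin> S"
        using e False by (auto simp: edge_complete_nbhd_iff)
      ultimately show ?thesis
        using connected_in_sym[of v a] connected_in_trans[of a v _ b] by blast
    qed
  next
    fix a b assume "{a, b} \<in> edges (G \<setminus>\<setminus> S)"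
    then show "(a, b) \<in> connected_in (Gv \<setminus>\<setminus> S)"
      by (intro connected_in_edge) (auto simp: edge_complete_nbhd_iff)
  qed simp
  then show ?thesis
    by (simp add: num_comp_del_def components_def)
qed

lemma complete_nbhd_neighbours_connected:
  assumes "v \<in> S" "a \<in> neighbours G v - S" "b \<in> neighbours G v - S"
  shows "(a, b) \<in> connected_in (Gv \<setminus>\<setminus> S)"
proof (cases "a = b")
  case True
  have "a \<in> verts (Gv \<setminus>\<setminus> S)"
    using assms neighboursD(1)[OF G] by auto
  then show ?thesis using True by (simp only: connected_in_refl)
next
  case False
  then show ?thesis
    using assms neighboursD(1)[OF G] by (intro connected_in_edge) (auto simp: edge_complete_nbhd_iff)
qed

text \<open>The remaining neighbours of \<open>v\<close> form a clique of \<open>G\<^sub>v\<close>, so \<open>v\<close> never separates them.\<close>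

lemma cut_sets_complete_nbhd: "cut_sets Gv = {S \<in> cut_sets G. v \<notin> S}"
proof -
  have v: "v \<notin> S" if S: "S \<in> cut_sets Gv" for S
  proof
    assume "v \<in> S"
    then obtain a b where "a \<in> neighbours G v - S" "b \<in> neighbours G v - S"
      "(a, b) \<notin> connected_in (Gv \<setminus>\<setminus> S)"
      using S unfolding cut_sets_iff_separates_neighbours[OF simple_complete_nbhd]
        neighbours_complete_nbhd[symmetric] by blast
    then show False
      using complete_nbhd_neighbours_connected \<open>v \<in> S\<close> by blast
  qed
  have "S \<in> cut_sets Gv \<longleftrightarrow> S \<in> cut_sets G" if "v \<notin> S" for S
    using that by (simp add: cut_sets_iff num_comp_del_complete_nbhd)
  then show ?thesis using v by blast
qed

lemma comb_unmixed_complete_nbhd: "comb_unmixed Gv"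
  unfolding comb_unmixed_def
proof
  fix S assume "S \<in> cut_sets Gv"
  then have S: "S \<in> cut_sets G" and v: "v \<notin> S"
    unfolding cut_sets_complete_nbhd by simp_all
  from S have "num_comp_del G S = card S + num_comp_del G {}"
    using U unfolding comb_unmixed_def by (rule bspec[rotated])
  then show "num_comp_del Gv S = card S + num_comp_del Gv {}"
    using num_comp_del_complete_nbhd[of "{}"] num_comp_del_complete_nbhd[OF v] by simp
qed

lemma accessible_complete_nbhd:
  "accessible_set_system (cut_sets G) \<Longrightarrow> accessible_set_system (cut_sets Gv)"
  unfolding cut_sets_complete_nbhd by (rule accessible_set_system_subsystem) auto

text \<open>In \<open>G\<^sub>v\<close> the vertex \<open>v\<close> sits in a clique with its neighbours: as long as one of them is left,
  deleting \<open>v\<close> neither splits nor removes a component.\<close>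

lemma num_comp_del_complete_nbhd_delete:
  assumes "v \<notin> S" "neighbours G v - S \<noteq> {}"
  shows "num_comp_del (Gv \<setminus>\<setminus> {v}) S = num_comp_del G S"
proof -
  have "num_comp_del (Gv \<setminus>\<setminus> {v}) S = num_comp_del Gv (insert v S)"
    by (simp add: num_comp_del_def delete_verts_delete_verts)
  also have "\<dots> = num_comp_del Gv S"
  proof (rule num_comp_del_insert_eq[OF simple_complete_nbhd])
    show "v \<in> verts Gv" "v \<notin> S" "neighbours Gv v - S \<noteq> {}"
      using assms cut_vertex_in_verts by (simp_all add: neighbours_complete_nbhd)
    fix a b assume "a \<in> neighbours Gv v - S" "b \<in> neighbours Gv v - S"
    then have "a \<in> neighbours G v - insert v S" "b \<in> neighbours G v - insert v S"
      using not_own_neighbour unfolding neighbours_complete_nbhd by auto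
    then show "(a, b) \<in> connected_in (Gv \<setminus>\<setminus> insert v S)"
      by (intro complete_nbhd_neighbours_connected) auto
  qed
  finally show ?thesis
    using num_comp_del_complete_nbhd[OF assms(1)] by simp
qed

text \<open>When all of \<open>N(v)\<close> has been deleted, up to one vertex, no edge of \<open>G\<^sub>v\<close> outside \<open>G\<close> is left.
  So a cut set \<open>S\<close> of \<open>G\<^sub>v - v\<close> around \<open>N(v)\<close> would be a cut set of \<open>G - v\<close>, and \<open>S \<union> {v}\<close> one of
  \<open>G\<close>, although \<open>v\<close> has no neighbour outside \<open>S\<close>.\<close>

lemma cut_sets_complete_nbhd_delete_neighbours:
  assumes S: "S \<in> cut_sets (Gv \<setminus>\<setminus> {v})"
  shows "neighbours G v - S \<noteq> {}"
proof
  assume N: "neighbours G v - S = {}"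
  have sub: "S \<subseteq> verts G - {v}" using S by (auto simp: cut_sets_def)
  have eq: "Gv \<setminus>\<setminus> {v} \<setminus>\<setminus> W = G \<setminus>\<setminus> {v} \<setminus>\<setminus> W" if "neighbours G v - W \<subseteq> {s}" for W s
    using that by (auto simp: delete_verts_def complete_nbhd_def)
  have num: "num_comp_del (Gv \<setminus>\<setminus> {v}) W = num_comp_del (G \<setminus>\<setminus> {v}) W"
    if "neighbours G v - W \<subseteq> {s}" for W s
    by (simp add: num_comp_del_def eq[OF that])
  have nums: "num_comp_del (Gv \<setminus>\<setminus> {v}) (S - {s}) = num_comp_del (G \<setminus>\<setminus> {v}) (S - {s})" for s
    using N by (intro num[of _ s]) blast
  have num0: "num_comp_del (Gv \<setminus>\<setminus> {v}) S = num_comp_del (G \<setminus>\<setminus> {v}) S"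
    using N by (intro num) blast
  have "S \<in> cut_sets (G \<setminus>\<setminus> {v})"
    using S by (simp add: cut_sets_iff num0 nums)
  then have "insert v S \<in> cut_sets G"
    using cut_sets_delete_cut_vertex_iff[OF sub] by blast
  then show False
    using N unfolding cut_sets_iff_separates_neighbours[OF G] by blast
qed

lemma cut_sets_complete_nbhd_delete:
  "cut_sets (Gv \<setminus>\<setminus> {v}) = {S \<in> cut_sets G. v \<notin> S \<and> neighbours G v - S \<noteq> {}}"
proof -
  have "S \<in> cut_sets (Gv \<setminus>\<setminus> {v}) \<longleftrightarrow> S \<in> cut_sets G" if "v \<notin> S" "neighbours G v - S \<noteq> {}" for S
  proof -
    have "num_comp_del (Gv \<setminus>\<setminus> {v}) (S - {s}) = num_comp_del G (S - {s})" for s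
      using that by (intro num_comp_del_complete_nbhd_delete) auto
    then show ?thesis
      using that by (auto simp: cut_sets_iff num_comp_del_complete_nbhd_delete)
  qed
  note iff = this
  have v: "v \<notin> S" if "S \<in> cut_sets (Gv \<setminus>\<setminus> {v})" for S
    using that by (auto simp: cut_sets_def)
  show ?thesis
  proof (intro subset_antisym subsetI)
    fix S assume S: "S \<in> cut_sets (Gv \<setminus>\<setminus> {v})"
    show "S \<in> {S \<in> cut_sets G. v \<notin> S \<and> neighbours G v - S \<noteq> {}}"
      using iff[OF v[OF S] cut_sets_complete_nbhd_delete_neighbours[OF S]] S v[OF S]
        cut_sets_complete_nbhd_delete_neighbours[OF S] by simp
  next
    fix S assume "S \<in> {S \<in> cut_sets G. v \<notin> S \<and> neighbours G v - S \<noteq> {}}"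
    then show "S \<in> cut_sets (Gv \<setminus>\<setminus> {v})"
      using iff[of S] by simp
  qed
qed

lemma comb_unmixed_complete_nbhd_delete: "comb_unmixed (Gv \<setminus>\<setminus> {v})"
  unfolding comb_unmixed_def
proof
  fix S assume "S \<in> cut_sets (Gv \<setminus>\<setminus> {v})"
  then have S: "S \<in> cut_sets G" and v: "v \<notin> S" "neighbours G v - S \<noteq> {}"
    unfolding cut_sets_complete_nbhd_delete by simp_all
  from S have "num_comp_del G S = card S + num_comp_del G {}"
    using U unfolding comb_unmixed_def by (rule bspec[rotated])
  then show "num_comp_del (Gv \<setminus>\<setminus> {v}) S = card S + num_comp_del (Gv \<setminus>\<setminus> {v}) {}"
    using num_comp_del_complete_nbhd_delete[OF v] num_comp_del_complete_nbhd_delete[of "{}"]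
      cut_sets_complete_nbhd_delete_neighbours[OF empty_in_cut_sets] by simp
qed

lemma accessible_complete_nbhd_delete:
  "accessible_set_system (cut_sets G) \<Longrightarrow> accessible_set_system (cut_sets (Gv \<setminus>\<setminus> {v}))"
  unfolding cut_sets_complete_nbhd_delete by (rule accessible_set_system_subsystem) auto

end

abbreviation keys :: "('m \<Rightarrow>\<^sub>0 'b::zero) \<Rightarrow> 'm set" where "keys \<equiv> Poly_Mapping.keys"
abbreviation lookup :: "('m \<Rightarrow>\<^sub>0 'b::zero) \<Rightarrow> 'm \<Rightarrow> 'b" where "lookup \<equiv> Poly_Mapping.lookup"
abbreviation single :: "'m \<Rightarrow> 'b \<Rightarrow> 'm \<Rightarrow>\<^sub>0 'b::zero" where "single \<equiv> Poly_Mapping.single"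
abbreviation polys :: "'x set \<Rightarrow> ('x, 'k::field) mpoly set" where
  "polys X \<equiv> carrier (polynomial_ring X)"

abbreviation Plus :: "'b set \<Rightarrow> 'c set \<Rightarrow> ('b + 'c) set" where "Plus \<equiv> Sum_Type.Plus"

lemma Inl_in_Plus_iff [simp]: "Inl a \<in> Plus A B \<longleftrightarrow> a \<in> A"
  and Inr_in_Plus_iff [simp]: "Inr b \<in> Plus A B \<longleftrightarrow> b \<in> B"
  by auto

section \<open>Ideals of the polynomial ring\<close>

lemma polys_iff: "p \<in> polys X \<longleftrightarrow> (\<forall>m\<in>keys p. keys m \<subseteq> X)"
  by (simp add: polynomial_ring_def)

lemma polynomial_ring_ops [simp]:
  "p \<oplus>\<^bsub>polynomial_ring X\<^esub> q = p + q"
  "p \<otimes>\<^bsub>polynomial_ring X\<^esub> q = p * q"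
  "\<zero>\<^bsub>polynomial_ring X\<^esub> = 0"
  "\<one>\<^bsub>polynomial_ring X\<^esub> = 1"
  by (simp_all add: polynomial_ring_def)

lemma polys_add: "p \<in> polys X \<Longrightarrow> q \<in> polys X \<Longrightarrow> p + q \<in> polys X"
  using ring.ring_simprules(1)[OF cring.axioms(1)[OF cring_polynomial_ring[of X]]]
  by simp

lemma polys_mult: "p \<in> polys X \<Longrightarrow> q \<in> polys X \<Longrightarrow> p * q \<in> polys X"
  using ring.ring_simprules(5)[OF cring.axioms(1)[OF cring_polynomial_ring[of X]]]
  by simp

lemma polys_zero: "0 \<in> polys X"
  by (simp add: polys_iff)

lemma polys_single: "keys m \<subseteq> X \<Longrightarrow> single m c \<in> polys X"
  by (simp add: polys_iff)

lemma polys_one: "1 \<in> polys X"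
  by (simp add: polys_iff)

lemma polys_uminus: "p \<in> polys X \<Longrightarrow> - p \<in> polys X"
  by (simp add: polys_iff)

lemma polys_diff: "p \<in> polys X \<Longrightarrow> q \<in> polys X \<Longrightarrow> p - q \<in> polys X"
  using polys_add[of p X "- q"] polys_uminus[of q X] by simp

lemma polys_sum: "(\<And>a. a \<in> A \<Longrightarrow> f a \<in> polys X) \<Longrightarrow> sum f A \<in> polys X"
  by (induction A rule: infinite_finite_induct) (auto simp: polys_zero polys_add)

lemma Var_in_polys: "x \<in> X \<Longrightarrow> Var x \<in> polys X"
  unfolding Var_def by (rule polys_single) simp

text \<open>All algebra below is done with the operations of the type; this and the next lemma translate
  from the ring record with its explicit carrier.\<close>

lemma ideal_polynomial_ring_iff:
  fixes I :: "('x, 'k::field) mpoly set"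
  shows "ideal I (polynomial_ring X) \<longleftrightarrow> I \<subseteq> polys X \<and> 0 \<in> I \<and>
    (\<forall>p\<in>I. \<forall>q\<in>I. p + q \<in> I) \<and> (\<forall>p\<in>polys X. \<forall>q\<in>I. p * q \<in> I)"
proof
  assume "ideal I (polynomial_ring X)"
  then interpret ideal I "polynomial_ring X" .
  show "I \<subseteq> polys X \<and> 0 \<in> I \<and>
    (\<forall>p\<in>I. \<forall>q\<in>I. p + q \<in> I) \<and> (\<forall>p\<in>polys X. \<forall>q\<in>I. p * q \<in> I)"
    using a_subset additive_subgroup.zero_closed[OF is_additive_subgroup]
      additive_subgroup.a_closed[OF is_additive_subgroup] I_l_closed by simp
next
  let ?R = "polynomial_ring X :: ('x, 'k) mpoly ring"
  assume I: "I \<subseteq> polys X \<and> 0 \<in> I \<and>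
    (\<forall>p\<in>I. \<forall>q\<in>I. p + q \<in> I) \<and> (\<forall>p\<in>polys X. \<forall>q\<in>I. p * q \<in> I)"
  interpret cring ?R by (rule cring_polynomial_ring)
  have neg: "- p \<in> I" if "p \<in> I" for p
  proof -
    have "(- 1) * p \<in> I"
      using I that polys_uminus[OF polys_one] by blast
    then show ?thesis by simp
  qed
  have inv: "inv\<^bsub>add_monoid ?R\<^esub> p = - p" if "p \<in> I" for p
  proof -
    have "\<ominus>\<^bsub>?R\<^esub> p = - p"
      by (rule minus_equality) (use I that neg in auto)
    then show ?thesis by (simp add: a_inv_def)
  qed
  show "ideal I ?R"
  proof (rule idealI)
    show "ring ?R" by (rule ring_axioms)
    show "subgroup I (add_monoid ?R)"
      by (rule subgroup.intro) (use I inv neg in auto)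
    fix p q :: "('x, 'k) mpoly" assume pq: "p \<in> I" "q \<in> polys X"
    then have "q * p \<in> I" using I by blast
    then show "q \<otimes>\<^bsub>?R\<^esub> p \<in> I" "p \<otimes>\<^bsub>?R\<^esub> q \<in> I"
      by (simp_all add: mult.commute)
  qed
qed

lemma primeideal_polynomial_ring_iff:
  fixes P :: "('x, 'k::field) mpoly set"
  shows "primeideal P (polynomial_ring X) \<longleftrightarrow> ideal P (polynomial_ring X) \<and> 1 \<notin> P \<and>
    (\<forall>p\<in>polys X. \<forall>q\<in>polys X. p * q \<in> P \<longrightarrow> p \<in> P \<or> q \<in> P)"
proof
  assume "primeideal P (polynomial_ring X)"
  then interpret primeideal P "polynomial_ring X" .
  show "ideal P (polynomial_ring X) \<and> 1 \<notin> P \<and>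
    (\<forall>p\<in>polys X. \<forall>q\<in>polys X. p * q \<in> P \<longrightarrow> p \<in> P \<or> q \<in> P)"
    using ideal_axioms one_imp_carrier I_notcarr I_prime by auto
next
  assume P: "ideal P (polynomial_ring X) \<and> 1 \<notin> P \<and>
    (\<forall>p\<in>polys X. \<forall>q\<in>polys X. p * q \<in> P \<longrightarrow> p \<in> P \<or> q \<in> P)"
  show "primeideal P (polynomial_ring X)"
    by (rule primeidealI) (use P cring_polynomial_ring polys_one in auto)
qed

lemma
  assumes "ideal I (polynomial_ring X)"
  shows ideal_subset_polys: "I \<subseteq> polys X"
    and ideal_zero: "0 \<in> I"
    and ideal_add: "\<And>p q. p \<in> I \<Longrightarrow> q \<in> I \<Longrightarrow> p + q \<in> I"
    and ideal_mult: "\<And>p q. p \<in> polys X \<Longrightarrow> q \<in> I \<Longrightarrow> p * q \<in> I"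
  using assms unfolding ideal_polynomial_ring_iff by auto

lemma ideal_diff:
  fixes I :: "('x, 'k::field) mpoly set"
  assumes "ideal I (polynomial_ring X)" "p \<in> I" "q \<in> I"
  shows "p - q \<in> I"
proof -
  have "(- 1) * q \<in> I"
    using ideal_mult[OF assms(1) polys_uminus[OF polys_one] assms(3)] .
  then show ?thesis
    using ideal_add[OF assms(1,2)] by fastforce
qed

section \<open>Linear extension of maps on monomials\<close>

text \<open>Three different maps arise in this way: the homomorphism with toric kernel, substitution into
  polynomials, and, with natural number coefficients, the additive map of exponents of a monomial map.\<close>

definition linear_extension ::
  "('m \<Rightarrow> ('n::comm_monoid_add \<Rightarrow>\<^sub>0 'k)) \<Rightarrow> ('m \<Rightarrow>\<^sub>0 'k::comm_semiring_1) \<Rightarrow> ('n \<Rightarrow>\<^sub>0 'k)" where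
  "linear_extension f p = (\<Sum>m\<in>keys p. single 0 (lookup p m) * f m)"

lemma lookup_scalar_mult: "lookup (single 0 c * p) m = c * lookup p m"
  by (simp flip: mult_map_scale_conv_mult add: Poly_Mapping.map.rep_eq when_def)

lemma linear_extension_superset:
  assumes "finite A" "keys p \<subseteq> A"
  shows "linear_extension f p = (\<Sum>m\<in>A. single 0 (lookup p m) * f m)"
  unfolding linear_extension_def
  by (rule sum.mono_neutral_left) (use assms in \<open>auto simp: in_keys_iff\<close>)

lemma linear_extension_zero [simp]: "linear_extension f 0 = 0"
  by (simp add: linear_extension_def)

lemma linear_extension_single [simp]: "linear_extension f (single m c) = single 0 c * f m"
  by (subst linear_extension_superset[of "{m}"]) auto

lemma linear_extension_add: "linear_extension f (p + q) = linear_extension f p + linear_extension f q"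
proof -
  let ?A = "keys p \<union> keys q"
  have A: "finite ?A" "keys p \<subseteq> ?A" "keys q \<subseteq> ?A" "keys (p + q) \<subseteq> ?A"
    using Poly_Mapping.keys_add[of p q] by auto
  show ?thesis
    unfolding linear_extension_superset[OF A(1,2)] linear_extension_superset[OF A(1,3)]
      linear_extension_superset[OF A(1,4)]
    by (simp add: lookup_add single_add distrib_right sum.distrib)
qed

lemma linear_extension_diff:
  fixes p q :: "'m \<Rightarrow>\<^sub>0 'k::comm_ring_1"
  shows "linear_extension f (p - q) = linear_extension f p - linear_extension f q"
  using linear_extension_add[of f "p - q" q] by (simp add: algebra_simps)

lemma linear_extension_sum: "linear_extension f (sum g A) = (\<Sum>a\<in>A. linear_extension f (g a))"
  by (induction A rule: infinite_finite_induct) (simp_all add: linear_extension_add)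

lemma poly_mapping_sum_single: "p = (\<Sum>m\<in>keys p. single m (lookup p m))"
proof (rule poly_mapping_eqI)
  fix k
  have "(\<Sum>m\<in>keys p. lookup (single m (lookup p m)) k) = (\<Sum>m\<in>keys p. if m = k then lookup p k else 0)"
    by (rule sum.cong) (auto simp: lookup_single when_def)
  also have "\<dots> = lookup p k"
    by (simp add: in_keys_iff)
  finally show "lookup p k = lookup (\<Sum>m\<in>keys p. single m (lookup p m)) k"
    by (simp add: lookup_sum)
qed

lemma linear_extension_mult:
  fixes p q :: "'m::comm_monoid_add \<Rightarrow>\<^sub>0 'k::comm_semiring_1"
    and f :: "'m \<Rightarrow> ('n::comm_monoid_add \<Rightarrow>\<^sub>0 'k)"
  assumes f: "\<And>m m'. f (m + m') = f m * f m'"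
  shows "linear_extension f (p * q) = linear_extension f p * linear_extension f q"
proof -
  have "p * q = (\<Sum>m\<in>keys p. single m (lookup p m)) * (\<Sum>m\<in>keys q. single m (lookup q m))"
    using poly_mapping_sum_single[of p] poly_mapping_sum_single[of q] by simp
  also have "\<dots> = (\<Sum>m\<in>keys p. \<Sum>m'\<in>keys q. single (m + m') (lookup p m * lookup q m'))"
    by (simp add: sum_product mult_single)
  finally have "linear_extension f (p * q) =
      (\<Sum>m\<in>keys p. \<Sum>m'\<in>keys q. single 0 (lookup p m * lookup q m') * (f m * f m'))"
    by (simp add: linear_extension_sum f)
  also have "\<dots> = (\<Sum>m\<in>keys p. \<Sum>m'\<in>keys q.
      (single 0 (lookup p m) * f m) * (single 0 (lookup q m') * f m'))"
  proof (intro sum.cong refl)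
    fix m m'
    have s: "single 0 (lookup p m * lookup q m') =
        (single 0 (lookup p m) * single 0 (lookup q m') :: 'n \<Rightarrow>\<^sub>0 'k)"
      by (simp add: mult_single)
    show "single 0 (lookup p m * lookup q m') * (f m * f m') =
        (single 0 (lookup p m) * f m) * (single 0 (lookup q m') * f m')"
      unfolding s by (simp only: mult_ac)
  qed
  also have "\<dots> = linear_extension f p * linear_extension f q"
    by (simp add: linear_extension_def sum_product)
  finally show ?thesis .
qed

lemma lookup_linear_extension:
  "lookup (linear_extension f p) k = (\<Sum>m\<in>keys p. lookup p m * lookup (f m) k)"
  by (simp add: linear_extension_def lookup_sum lookup_scalar_mult)

lemma lookup_linear_extension_superset:
  assumes "finite A" "keys p \<subseteq> A"
  shows "lookup (linear_extension f p) k = (\<Sum>m\<in>A. lookup p m * lookup (f m) k)"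
  by (simp add: linear_extension_superset[OF assms] lookup_sum lookup_scalar_mult)

lemma single_eq_0_iff: "single m c = 0 \<longleftrightarrow> c = 0"
  by (metis lookup_single_eq lookup_zero single_zero)

lemma single_one_inject: "single m (1::'k::zero_neq_one) = single m' 1 \<longleftrightarrow> m = m'"
  by (metis lookup_single_eq lookup_single_not_eq zero_neq_one)

lemma single_0_Suc_0 [simp]: "single 0 (Suc 0) = 1"
  by (metis One_nat_def single_one)

lemma keys_add_nat: "keys (m + m' :: 'x \<Rightarrow>\<^sub>0 nat) = keys m \<union> keys m'"
  by (auto simp: in_keys_iff lookup_add)

section \<open>Toric ideals of partitions\<close>

text \<open>Let \<open>r\<close> assign to each vertex a representative of its block. The monomial map
  \<open>x\<^sub>i \<mapsto> a\<^sub>i\<close>, \<open>y\<^sub>i \<mapsto> a\<^sub>i t\<^bsub>r i\<^esub>\<close> parametrizes, block by block, generic \<open>2 \<times> m\<close> matrices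
  of rank one; in addition the variables in \<open>Z\<close> are sent to zero. The target variables
  \<open>a\<^sub>i\<close> and \<open>t\<^sub>c\<close> are numbered by even and odd natural numbers: their linear order gives leading
  monomials, so the target is a domain and the kernels are prime.\<close>

definition toric_weight :: "'a set \<Rightarrow> ('a \<Rightarrow> 'a) \<Rightarrow> 'a + 'a \<Rightarrow> (nat \<Rightarrow>\<^sub>0 nat)" where
  "toric_weight V r x = (case x of
     Inl i \<Rightarrow> single (2 * to_nat_on V i) 1
   | Inr i \<Rightarrow> single (2 * to_nat_on V i) 1 + single (Suc (2 * to_nat_on V (r i))) 1)"

abbreviation toric_exponent :: "'a set \<Rightarrow> ('a \<Rightarrow> 'a) \<Rightarrow> ('a + 'a \<Rightarrow>\<^sub>0 nat) \<Rightarrow> (nat \<Rightarrow>\<^sub>0 nat)" where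
  "toric_exponent V r \<equiv> linear_extension (toric_weight V r)"

definition toric_monomial ::
  "'a set \<Rightarrow> ('a + 'a) set \<Rightarrow> ('a \<Rightarrow> 'a) \<Rightarrow> ('a + 'a \<Rightarrow>\<^sub>0 nat) \<Rightarrow> (nat, 'k::field) mpoly" where
  "toric_monomial V Z r m = (if keys m \<inter> Z = {} then single (toric_exponent V r m) 1 else 0)"

abbreviation toric_map ::
  "'a set \<Rightarrow> ('a + 'a) set \<Rightarrow> ('a \<Rightarrow> 'a) \<Rightarrow> ('a + 'a, 'k) mpoly \<Rightarrow> (nat, 'k::field) mpoly" where
  "toric_map V Z r \<equiv> linear_extension (toric_monomial V Z r)"

definition toric_kernel :: "'a set \<Rightarrow> ('a + 'a) set \<Rightarrow> ('a \<Rightarrow> 'a) \<Rightarrow> ('a + 'a, 'k::field) mpoly set" where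
  "toric_kernel V Z r = {p \<in> polys (Plus V V). toric_map V Z r p = 0}"

definition minor :: "'a \<Rightarrow> 'a \<Rightarrow> ('a + 'a, 'k::field) mpoly" where
  "minor i j = Var (Inl i) * Var (Inr j) - Var (Inl j) * Var (Inr i)"

lemma toric_monomial_add:
  "toric_monomial V Z r (m + m') = toric_monomial V Z r m * toric_monomial V Z r m'"
  by (auto simp: toric_monomial_def keys_add_nat linear_extension_add mult_single)

lemma toric_map_mult: "toric_map V Z r (p * q) = toric_map V Z r p * toric_map V Z r q"
  by (rule linear_extension_mult) (rule toric_monomial_add)

lemma toric_map_one: "toric_map V Z r 1 = 1"
proof -
  have "toric_map V Z r 1 = toric_map V Z r (single 0 1)" by simp
  also have "\<dots> = toric_monomial V Z r 0"
    by (simp only: linear_extension_single) simp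
  also have "\<dots> = 1" by (simp add: toric_monomial_def)
  finally show ?thesis .
qed

lemma primeideal_toric_kernel: "primeideal (toric_kernel V Z r) (polynomial_ring (Plus V V))"
  unfolding primeideal_polynomial_ring_iff ideal_polynomial_ring_iff
  by (auto simp: toric_kernel_def linear_extension_add toric_map_mult toric_map_one
      polys_add polys_mult polys_zero)

lemma ideal_toric_kernel: "ideal (toric_kernel V Z r) (polynomial_ring (Plus V V))"
  using primeideal_toric_kernel primeideal.axioms(1) by blast

lemma Var_in_toric_kernel_iff:
  assumes "x \<in> Plus V V"
  shows "(Var x :: ('a + 'a, 'k::field) mpoly) \<in> toric_kernel V Z r \<longleftrightarrow> x \<in> Z"
proof -
  have "toric_map V Z r (Var x :: ('a + 'a, 'k) mpoly) = toric_monomial V Z r (single x 1)"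
    by (simp add: Var_def)
  then show ?thesis
    using Var_in_polys[OF assms]
    by (cases "x \<in> Z") (simp_all add: toric_kernel_def toric_monomial_def single_eq_0_iff)
qed

lemma Var_mult_Var: "Var x * Var y = single (single x 1 + single y 1) 1"
  by (simp add: Var_def mult_single)

lemma minor_in_polys: "i \<in> V \<Longrightarrow> j \<in> V \<Longrightarrow> minor i j \<in> polys (Plus V V)"
  unfolding minor_def by (intro polys_diff polys_mult Var_in_polys) auto

lemma minor_self [simp]: "minor i i = 0"
  by (simp add: minor_def)

lemma toric_map_minor: "toric_map V Z r (minor i j) =
    toric_monomial V Z r (single (Inl i) 1 + single (Inr j) 1) -
    toric_monomial V Z r (single (Inl j) 1 + single (Inr i) 1)"
  by (simp add: minor_def linear_extension_diff Var_mult_Var)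

text \<open>A vertex one of whose variables is sent to zero has to be alone in its block: if the other
  variable survives, then so do the minors with another vertex of the block.\<close>

definition isolated_in :: "'a set \<Rightarrow> ('a + 'a) set \<Rightarrow> ('a \<Rightarrow> 'a) \<Rightarrow> bool" where
  "isolated_in V Z r \<longleftrightarrow>
     (\<forall>i\<in>V. Inl i \<in> Z \<or> Inr i \<in> Z \<longrightarrow> (\<forall>j\<in>V. r j = r i \<longrightarrow> j = i))"

lemma minor_in_toric_kernel:
  assumes iso: "isolated_in V Z r" and V: "i \<in> V" "j \<in> V" and r: "r i = r j"
  shows "(minor i j :: ('a + 'a, 'k::field) mpoly) \<in> toric_kernel V Z r"
proof (cases "i = j")
  case True
  then show ?thesis by (simp add: toric_kernel_def polys_zero)
next
  case False
  then have "\<not> (Inl i \<in> Z \<or> Inr i \<in> Z)" "\<not> (Inl j \<in> Z \<or> Inr j \<in> Z)"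
    using iso V r unfolding isolated_in_def by metis+
  then have "toric_map V Z r (minor i j :: ('a + 'a, 'k) mpoly) = 0"
    using r unfolding toric_map_minor
    by (simp add: toric_monomial_def keys_add_nat linear_extension_add toric_weight_def add_ac)
  then show ?thesis
    using minor_in_polys[OF V] by (simp add: toric_kernel_def)
qed

lemma lookup_toric_weight_odd:
  assumes V: "finite V" and "c \<in> V" "r i \<in> V"
  shows "lookup (toric_weight V r (Inl i)) (Suc (2 * to_nat_on V c)) = 0"
    and "lookup (toric_weight V r (Inr i)) (Suc (2 * to_nat_on V c)) = (if r i = c then 1 else 0)"
proof -
  have "2 * to_nat_on V i \<noteq> Suc (2 * to_nat_on V c)"
    by presburger
  moreover have "to_nat_on V (r i) = to_nat_on V c \<longleftrightarrow> r i = c"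
    using assms by (simp add: countable_finite)
  ultimately show "lookup (toric_weight V r (Inl i)) (Suc (2 * to_nat_on V c)) = 0"
    "lookup (toric_weight V r (Inr i)) (Suc (2 * to_nat_on V c)) = (if r i = c then 1 else 0)"
    by (simp_all add: toric_weight_def lookup_add lookup_single when_def)
qed

lemma lookup_toric_weight_even:
  assumes V: "finite V" and "i \<in> V" "j \<in> V"
  shows "lookup (toric_weight V r (Inl i)) (2 * to_nat_on V j) = (if i = j then 1 else 0)"
    and "lookup (toric_weight V r (Inr i)) (2 * to_nat_on V j) = (if i = j then 1 else 0)"
proof -
  have "Suc (2 * to_nat_on V (r i)) \<noteq> 2 * to_nat_on V j"
    by presburger
  moreover have "to_nat_on V i = to_nat_on V j \<longleftrightarrow> i = j"
    using assms by (simp add: countable_finite)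
  ultimately show "lookup (toric_weight V r (Inl i)) (2 * to_nat_on V j) = (if i = j then 1 else 0)"
    "lookup (toric_weight V r (Inr i)) (2 * to_nat_on V j) = (if i = j then 1 else 0)"
    by (simp_all add: toric_weight_def lookup_add lookup_single when_def)
qed

lemma minor_notin_toric_kernel:
  assumes V: "finite V" "r i \<in> V" "r j \<in> V"
    and Z: "{Inl i, Inr i, Inl j, Inr j} \<inter> Z = {}" and r: "r i \<noteq> r j"
  shows "minor i j \<notin> toric_kernel V Z r"
proof
  let ?m = "single (Inl i) 1 + single (Inr j) 1 :: 'a + 'a \<Rightarrow>\<^sub>0 nat"
  let ?m' = "single (Inl j) 1 + single (Inr i) 1 :: 'a + 'a \<Rightarrow>\<^sub>0 nat"
  let ?k = "Suc (2 * to_nat_on V (r j))"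
  assume "minor i j \<in> toric_kernel V Z r"
  then have "toric_exponent V r ?m = toric_exponent V r ?m'"
    using Z by (simp add: toric_kernel_def toric_map_minor toric_monomial_def keys_add_nat
        single_one_inject)
  then have "lookup (toric_exponent V r ?m) ?k = lookup (toric_exponent V r ?m') ?k"
    by simp
  then show False
    using r lookup_toric_weight_odd[OF V(1) V(3), of r i] lookup_toric_weight_odd[OF V(1) V(3), of r j] V
    by (simp add: linear_extension_add lookup_add)
qed

lemma
  assumes V: "finite V" and m: "keys m \<subseteq> Plus V V" and c: "c \<in> V"
  shows lookup_toric_exponent_even:
      "lookup (toric_exponent V r m) (2 * to_nat_on V c) = lookup m (Inl c) + lookup m (Inr c)"
    and lookup_toric_exponent_odd:
      "(\<And>i. i \<in> V \<Longrightarrow> r i \<in> V) \<Longrightarrow> lookup (toric_exponent V r m) (Suc (2 * to_nat_on V c)) =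
        (\<Sum>i\<in>{i\<in>V. r i = c}. lookup m (Inr i))"
proof -
  have fin: "finite (Plus V V)" using V by simp
  have "lookup (toric_exponent V r m) (2 * to_nat_on V c) =
     (\<Sum>i\<in>V. if i = c then lookup m (Inl i) else 0) + (\<Sum>i\<in>V. if i = c then lookup m (Inr i) else 0)"
    unfolding lookup_linear_extension_superset[OF fin m] sum.Plus[OF V V]
    by (intro arg_cong2[where f="(+)"] sum.cong refl)
      (simp_all add: lookup_toric_weight_even[OF V _ c])
  then show "lookup (toric_exponent V r m) (2 * to_nat_on V c) = lookup m (Inl c) + lookup m (Inr c)"
    using V c by simp
  assume r: "\<And>i. i \<in> V \<Longrightarrow> r i \<in> V"
  have "lookup (toric_exponent V r m) (Suc (2 * to_nat_on V c)) =
     (\<Sum>i\<in>V. 0) + (\<Sum>i\<in>V. if r i = c then lookup m (Inr i) else 0)"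
    unfolding lookup_linear_extension_superset[OF fin m] sum.Plus[OF V V]
    by (intro arg_cong2[where f="(+)"] sum.cong refl)
      (simp_all add: lookup_toric_weight_odd[OF V c] r)
  then show "lookup (toric_exponent V r m) (Suc (2 * to_nat_on V c)) =
        (\<Sum>i\<in>{i\<in>V. r i = c}. lookup m (Inr i))"
    using V by (simp add: sum.inter_filter)
qed

text \<open>Monomials with the same image under the monomial map are connected by exchanges
  \<open>x\<^sub>j y\<^sub>i \<leadsto> x\<^sub>i y\<^sub>j\<close> inside a block, each of which is a multiple of a minor. If \<open>y\<^sub>i\<close> occurs too often
  in \<open>m\<close>, then some \<open>y\<^sub>j\<close> from the same block occurs too rarely, because the \<open>t\<close>-exponents agree; as the
  \<open>a\<close>-exponents agree, \<open>x\<^sub>j\<close> occurs in \<open>m\<close>, and the exchange brings \<open>m\<close> closer to \<open>m'\<close>.\<close>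

lemma monomial_diff_in_ideal:
  fixes Q :: "('a + 'a, 'k::field) mpoly set"
  assumes V: "finite V" and r: "\<And>i. i \<in> V \<Longrightarrow> r i \<in> V"
    and Q: "ideal Q (polynomial_ring (Plus V V))"
    and minors: "\<And>i j. \<lbrakk>i \<in> V; j \<in> V; r i = r j\<rbrakk> \<Longrightarrow> minor i j \<in> Q"
    and m: "keys m \<subseteq> Plus V V" and m': "keys m' \<subseteq> Plus V V"
    and eq: "toric_exponent V r m = toric_exponent V r m'"
  shows "single m 1 - single m' 1 \<in> Q"
  using m eq
proof (induction "\<Sum>i\<in>V. lookup m (Inr i) - lookup m' (Inr i)" arbitrary: m rule: less_induct)
  case less
  note m = less.prems(1) and eq = less.prems(2)
  have even: "lookup m (Inl c) + lookup m (Inr c) = lookup m' (Inl c) + lookup m' (Inr c)"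
    if "c \<in> V" for c
    using lookup_toric_exponent_even[OF V m that, of r] lookup_toric_exponent_even[OF V m' that, of r] eq
    by simp
  have odd: "(\<Sum>i\<in>{i\<in>V. r i = c}. lookup m (Inr i)) = (\<Sum>i\<in>{i\<in>V. r i = c}. lookup m' (Inr i))"
    if "c \<in> V" for c
    using lookup_toric_exponent_odd[OF V m that, of r] lookup_toric_exponent_odd[OF V m' that, of r] eq r
    by simp
  have fin: "finite {i\<in>V. r i = c}" for c using V by simp
  show ?case
  proof (cases "\<exists>i\<in>V. lookup m' (Inr i) < lookup m (Inr i)")
    case False
    have Inr: "lookup m (Inr i) = lookup m' (Inr i)" if i: "i \<in> V" for i
    proof (rule ccontr)
      assume "lookup m (Inr i) \<noteq> lookup m' (Inr i)"
      then have "lookup m (Inr i) < lookup m' (Inr i)" using False i by force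
      then have "(\<Sum>j\<in>{j\<in>V. r j = r i}. lookup m (Inr j)) < (\<Sum>j\<in>{j\<in>V. r j = r i}. lookup m' (Inr j))"
        using False i by (intro sum_strict_mono_ex1[OF fin]) (auto simp: not_less)
      then show False using odd[OF r[OF i]] by simp
    qed
    have "m = m'"
    proof (rule poly_mapping_eqI)
      fix x
      show "lookup m x = lookup m' x"
      proof (cases "x \<in> Plus V V")
        case True
        then show ?thesis using Inr even by (auto simp: Plus_def)
      next
        case False
        then have "x \<notin> keys m" "x \<notin> keys m'" using m m' by auto
        then show ?thesis by (simp add: in_keys_iff)
      qed
    qed
    then show ?thesis using ideal_zero[OF Q] by simp
  next
    case True
    then obtain i where i: "i \<in> V" "lookup m' (Inr i) < lookup m (Inr i)" by blast
    have "\<exists>j\<in>{j\<in>V. r j = r i}. lookup m (Inr j) < lookup m' (Inr j)"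
    proof (rule ccontr)
      assume "\<not> ?thesis"
      then have "(\<Sum>j\<in>{j\<in>V. r j = r i}. lookup m' (Inr j)) < (\<Sum>j\<in>{j\<in>V. r j = r i}. lookup m (Inr j))"
        using i by (intro sum_strict_mono_ex1[OF fin]) (auto simp: not_less)
      then show False using odd[OF r[OF i(1)]] by simp
    qed
    then obtain j where j: "j \<in> V" "r j = r i" "lookup m (Inr j) < lookup m' (Inr j)" by blast
    have ij: "i \<noteq> j" using i j by auto
    have Inl: "0 < lookup m (Inl j)" using even[OF j(1)] j(3) by linarith
    define n where "n = m - single (Inl j) 1 - single (Inr i) 1"
    define m2 where "m2 = n + (single (Inl i) 1 + single (Inr j) 1)"
    have m_eq: "m = n + (single (Inl j) 1 + single (Inr i) 1)"
      by (rule poly_mapping_eqI)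
        (use i Inl in \<open>auto simp: n_def lookup_add lookup_minus lookup_single when_def\<close>)
    have "keys n \<subseteq> Plus V V"
      using m by (subst (asm) m_eq) (simp add: keys_add_nat)
    then have n: "single n 1 \<in> polys (Plus V V)" and m2: "keys m2 \<subseteq> Plus V V"
      using i j by (auto simp: polys_single m2_def keys_add_nat)
    have "toric_exponent V r m2 = toric_exponent V r m"
      by (subst m_eq) (simp add: m2_def linear_extension_add toric_weight_def j(2) add_ac)
    moreover have "(\<Sum>k\<in>V. lookup m2 (Inr k) - lookup m' (Inr k)) <
        (\<Sum>k\<in>V. lookup m (Inr k) - lookup m' (Inr k))"
    proof (rule sum_strict_mono_ex1[OF V])
      have m2_Inr: "lookup m2 (Inr k) = lookup m (Inr k) - (if k = i then 1 else 0) + (if k = j then 1 else 0)"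
        for k
        by (simp add: m2_def n_def lookup_add lookup_minus lookup_single when_def)
      show "\<forall>k\<in>V. lookup m2 (Inr k) - lookup m' (Inr k) \<le> lookup m (Inr k) - lookup m' (Inr k)"
        using j(3) ij by (auto simp: m2_Inr)
      show "\<exists>k\<in>V. lookup m2 (Inr k) - lookup m' (Inr k) < lookup m (Inr k) - lookup m' (Inr k)"
        using i ij by (intro bexI[of _ i]) (auto simp: m2_Inr)
    qed
    ultimately have "single m2 1 - single m' 1 \<in> Q"
      using less.hyps[of m2] m2 eq by simp
    moreover have "single m 1 - single m2 1 = single n 1 * (minor j i :: ('a + 'a, 'k) mpoly)"
      unfolding minor_def Var_mult_Var right_diff_distrib mult_single
      by (subst m_eq) (simp add: m2_def)
    then have "single m 1 - single m2 1 \<in> Q"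
      using ideal_mult[OF Q n minors[OF j(1) i(1) j(2)]] by simp
    ultimately have "(single m 1 - single m2 1) + (single m2 1 - single m' 1) \<in> Q"
      by (intro ideal_add[OF Q])
    then show ?thesis by simp
  qed
qed

text \<open>So the kernel is generated by the obvious elements: the variables in \<open>Z\<close> and the minors
  within the blocks. A monomial of a polynomial \<open>p\<close> in the kernel is either killed by the map, or its
  image is cancelled by the image of another monomial of \<open>p\<close>; in both cases \<open>p\<close> can be made shorter by a
  known element.\<close>

lemma toric_kernel_subset:
  fixes Q :: "('a + 'a, 'k::field) mpoly set"
  assumes V: "finite V" and r: "\<And>i. i \<in> V \<Longrightarrow> r i \<in> V"
    and Q: "ideal Q (polynomial_ring (Plus V V))"
    and vars: "\<And>x. \<lbrakk>x \<in> Z; x \<in> Plus V V\<rbrakk> \<Longrightarrow> Var x \<in> Q"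
    and minors: "\<And>i j. \<lbrakk>i \<in> V; j \<in> V; r i = r j\<rbrakk> \<Longrightarrow> minor i j \<in> Q"
  shows "toric_kernel V Z r \<subseteq> Q"
proof
  fix p :: "('a + 'a, 'k) mpoly" assume "p \<in> toric_kernel V Z r"
  then show "p \<in> Q"
  proof (induction "card (keys p)" arbitrary: p rule: less_induct)
    case less
    note K = less.prems
    show ?case
    proof (cases "p = 0")
      case True
      then show ?thesis using ideal_zero[OF Q] by simp
    next
      case False
      then obtain m where m: "m \<in> keys p" by fastforce
      have mX: "keys m \<subseteq> Plus V V" using K m by (auto simp: toric_kernel_def polys_iff)
      define c where "c = lookup p m"
      have c: "c \<noteq> 0" using m by (simp add: c_def in_keys_iff)
      have drop: "card (keys q) < card (keys p)"
        if "\<And>k. lookup p k = 0 \<Longrightarrow> lookup q k = 0" "lookup q m = 0" for q :: "('a + 'a, 'k) mpoly"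
      proof (rule psubset_card_mono)
        show "keys q \<subset> keys p" using m that by (auto simp: in_keys_iff)
      qed simp
      show ?thesis
      proof (cases "keys m \<inter> Z = {}")
        case False
        then obtain x where x: "x \<in> keys m" "x \<in> Z" "x \<in> Plus V V" using mX by blast
        have "m = (m - single x 1) + single x 1"
          by (rule poly_mapping_eqI)
            (use x(1) in \<open>auto simp: lookup_add lookup_minus lookup_single when_def in_keys_iff\<close>)
        then have "single m c = single (m - single x 1) c * Var x"
          by (simp add: Var_def mult_single)
        moreover have "keys (m - single x 1) \<subseteq> Plus V V"
          using mX by (auto simp: in_keys_iff lookup_minus)
        ultimately have mQ: "single m c \<in> Q"
          using ideal_mult[OF Q polys_single vars[OF x(2,3)]] by simp
        have "single m c \<in> toric_kernel V Z r"
          using False mX by (simp add: toric_kernel_def polys_single toric_monomial_def)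
        then have "p - single m c \<in> toric_kernel V Z r"
          using ideal_diff[OF ideal_toric_kernel K] by blast
        moreover have "card (keys (p - single m c)) < card (keys p)"
          by (rule drop) (use c in \<open>auto simp: lookup_minus lookup_single when_def c_def\<close>)
        ultimately have "p - single m c \<in> Q" using less.hyps by blast
        from ideal_add[OF Q this mQ] show ?thesis by simp
      next
        case True
        \<comment> \<open>Otherwise the image of \<open>m\<close> would survive in the image of \<open>p\<close>.\<close>
        have "\<exists>m'\<in>keys p. m' \<noteq> m \<and> keys m' \<inter> Z = {} \<and> toric_exponent V r m' = toric_exponent V r m"
        proof (rule ccontr)
          assume *: "\<not> ?thesis"
          have "lookup (toric_map V Z r p) (toric_exponent V r m) =
              (\<Sum>m'\<in>keys p. if m' = m then c else 0)"
            unfolding lookup_linear_extension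
            by (intro sum.cong refl)
              (use * True in \<open>auto simp: toric_monomial_def c_def lookup_single when_def\<close>)
          also have "\<dots> = c" using m by simp
          finally show False using K c by (simp add: toric_kernel_def)
        qed
        then obtain m' where m': "m' \<in> keys p" "m' \<noteq> m" "keys m' \<inter> Z = {}"
          "toric_exponent V r m' = toric_exponent V r m" by blast
        have m'X: "keys m' \<subseteq> Plus V V" using K m' by (auto simp: toric_kernel_def polys_iff)
        let ?d = "single m c - single m' c :: ('a + 'a, 'k) mpoly"
        have "?d \<in> toric_kernel V Z r"
          using True m' mX m'X
          by (simp add: toric_kernel_def polys_diff polys_single toric_monomial_def
              linear_extension_diff)
        then have "p - ?d \<in> toric_kernel V Z r"
          using ideal_diff[OF ideal_toric_kernel K] by blast
        moreover have "card (keys (p - ?d)) < card (keys p)"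
          by (rule drop)
            (use c m'(1,2) in \<open>auto simp: lookup_minus lookup_single when_def c_def in_keys_iff\<close>)
        ultimately have "p - ?d \<in> Q" using less.hyps by blast
        moreover have "?d = single 0 c * (single m 1 - single m' 1)"
          by (simp add: right_diff_distrib mult_single)
        moreover have "single 0 c * (single m 1 - single m' 1) \<in> Q"
          by (rule ideal_mult[OF Q polys_single monomial_diff_in_ideal[OF V r Q minors mX m'X]])
            (use m'(4)[symmetric] in simp_all)
        ultimately have "p - ?d \<in> Q" "?d \<in> Q"
          by (simp_all only:)
        then have "(p - ?d) + ?d \<in> Q" by (rule ideal_add[OF Q])
        then show ?thesis by simp
      qed
    qed
  qed
qed

section \<open>Chains of prime ideals\<close>

definition prime_chain :: "('r, 'm) ring_scheme \<Rightarrow> nat \<Rightarrow> 'r set \<Rightarrow> bool" where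
  "prime_chain R n P \<longleftrightarrow> (\<exists>C :: nat \<Rightarrow> 'r set.
     (\<forall>i\<le>n. primeideal (C i) R) \<and> (\<forall>i<n. C i \<subset> C (Suc i)) \<and> C n = P)"

lemma prime_chain_0: "primeideal P R \<Longrightarrow> prime_chain R 0 P"
  unfolding prime_chain_def by (intro exI[of _ "\<lambda>_. P"]) simp

lemma prime_chain_Suc:
  assumes "prime_chain R n P" "P \<subset> Q" "primeideal Q R"
  shows "prime_chain R (Suc n) Q"
proof -
  obtain C where C: "\<forall>i\<le>n. primeideal (C i) R" "\<forall>i<n. C i \<subset> C (Suc i)" "C n = P"
    using assms(1) unfolding prime_chain_def by blast
  show ?thesis
    unfolding prime_chain_def
    by (intro exI[of _ "C(Suc n := Q)"]) (use C assms(2,3) in \<open>auto simp: le_Suc_eq less_Suc_eq\<close>)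
qed

lemma prime_chain_SucE:
  assumes "prime_chain R (Suc n) Q"
  obtains P where "prime_chain R n P" "P \<subset> Q"
proof -
  obtain C where C: "\<forall>i\<le>Suc n. primeideal (C i) R" "\<forall>i<Suc n. C i \<subset> C (Suc i)" "C (Suc n) = Q"
    using assms unfolding prime_chain_def by blast
  have "prime_chain R n (C n)"
    unfolding prime_chain_def using C(1,2) by (intro exI[of _ C]) auto
  moreover have "C n \<subset> Q" using C(2,3) by blast
  ultimately show ?thesis by (rule that)
qed

lemma prime_chain_primeideal: "prime_chain R n P \<Longrightarrow> primeideal P R"
  unfolding prime_chain_def by blast

lemma height_eqI:
  assumes "prime_chain R n P" and "\<And>k. prime_chain R k P \<Longrightarrow> k \<le> n"
  shows "height R P = enat n"
proof -
  have "height R P = Sup {enat k | k. prime_chain R k P}"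
    by (simp add: height_def prime_chain_def)
  also have "\<dots> = enat n"
    by (rule antisym[OF Sup_least Sup_upper]) (use assms in auto)
  finally show ?thesis .
qed

section \<open>Algebraic independence modulo a prime\<close>

definition power_product :: "(nat \<Rightarrow> ('x, 'k::field) mpoly) \<Rightarrow> (nat \<Rightarrow>\<^sub>0 nat) \<Rightarrow> ('x, 'k) mpoly" where
  "power_product F m = (\<Prod>i\<in>keys m. F i ^ lookup m i)"

abbreviation substitute :: "(nat \<Rightarrow> ('x, 'k::field) mpoly) \<Rightarrow> (nat, 'k) mpoly \<Rightarrow> ('x, 'k) mpoly" where
  "substitute F \<equiv> linear_extension (power_product F)"

text \<open>Algebraic independence of \<open>F 0, \<dots>, F (d - 1)\<close> in the quotient by \<open>P\<close>, expressed in the ring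
  itself.\<close>

definition independent_mod ::
  "'x set \<Rightarrow> ('x, 'k::field) mpoly set \<Rightarrow> nat \<Rightarrow> (nat \<Rightarrow> ('x, 'k) mpoly) \<Rightarrow> bool" where
  "independent_mod X P d F \<longleftrightarrow> (\<forall>i<d. F i \<in> polys X) \<and>
     (\<forall>c\<in>polys {..<d}. substitute F c \<in> P \<longrightarrow> c = 0)"

lemma power_product_superset:
  "finite A \<Longrightarrow> keys m \<subseteq> A \<Longrightarrow> power_product F m = (\<Prod>i\<in>A. F i ^ lookup m i)"
  unfolding power_product_def by (rule prod.mono_neutral_left) (auto simp: in_keys_iff)

lemma power_product_add: "power_product F (m + m') = power_product F m * power_product F m'"
proof -
  let ?A = "keys m \<union> keys m'"
  have A: "finite ?A" by simp
  show ?thesis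
    by (simp add: power_product_superset[OF A] keys_add_nat lookup_add power_add prod.distrib)
qed

lemma substitute_mult: "substitute F (p * q) = substitute F p * substitute F q"
  by (rule linear_extension_mult) (rule power_product_add)

lemma substitute_Var: "substitute F (Var i) = F i"
  by (simp add: Var_def power_product_def)

lemma substitute_cong:
  "(\<And>m i. \<lbrakk>m \<in> keys c; i \<in> keys m\<rbrakk> \<Longrightarrow> F i = G i) \<Longrightarrow> substitute F c = substitute G c"
  unfolding linear_extension_def power_product_def
  by (intro sum.cong prod.cong arg_cong2[where f = "(*)"] refl) auto

lemma polys_power: "p \<in> polys X \<Longrightarrow> p ^ n \<in> polys X"
  by (induction n) (auto simp: polys_one polys_mult)

lemma polys_prod: "(\<And>a. a \<in> A \<Longrightarrow> f a \<in> polys X) \<Longrightarrow> prod f A \<in> polys X"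
  by (induction A rule: infinite_finite_induct) (auto simp: polys_one polys_mult)

lemma power_product_in_polys:
  "(\<And>i. i \<in> keys m \<Longrightarrow> F i \<in> polys X) \<Longrightarrow> power_product F m \<in> polys X"
  unfolding power_product_def by (intro polys_prod polys_power) auto

lemma substitute_in_polys:
  assumes "\<And>i. i \<in> I \<Longrightarrow> F i \<in> polys X" "c \<in> polys I"
  shows "substitute F c \<in> polys X"
  unfolding linear_extension_def
  by (intro polys_sum polys_mult polys_single power_product_in_polys)
    (use assms in \<open>auto simp: polys_iff[of c]\<close>)

lemma keys_sum_single: "keys (\<Sum>a\<in>A. single (f a) (g a)) \<subseteq> f ` A"
proof
  fix k assume k: "k \<in> keys (\<Sum>a\<in>A. single (f a) (g a))"
  show "k \<in> f ` A"
  proof (rule ccontr)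
    assume "k \<notin> f ` A"
    then have "lookup (\<Sum>a\<in>A. single (f a) (g a)) k = (\<Sum>a\<in>A. 0)"
      unfolding lookup_sum by (intro sum.cong refl) (auto simp: lookup_single when_def)
    then show False using k by (simp add: in_keys_iff)
  qed
qed

lemma polys_split_variable:
  fixes c :: "('x, 'k::field) mpoly"
  assumes c: "c \<in> polys (insert x I)"
  obtains c0 c1 where "c = c0 + Var x * c1" "c0 \<in> polys I" "c1 \<in> polys (insert x I)"
    "\<And>m. m \<in> keys c1 \<Longrightarrow> \<exists>m'\<in>keys c. lookup m' x = Suc (lookup m x)"
proof
  let ?A = "{m \<in> keys c. lookup m x = 0}" and ?B = "{m \<in> keys c. lookup m x \<noteq> 0}"
  let ?c0 = "\<Sum>m\<in>?A. single m (lookup c m)"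
  let ?c1 = "\<Sum>m\<in>?B. single (m - single x 1) (lookup c m)"
  have keys: "keys m \<subseteq> insert x I" if "m \<in> keys c" for m
    using c that by (auto simp: polys_iff)
  have shift: "single x 1 + (m - single x 1) = m" if "lookup m x \<noteq> 0" for m :: "'x \<Rightarrow>\<^sub>0 nat"
    by (rule poly_mapping_eqI) (use that in \<open>auto simp: lookup_add lookup_minus lookup_single when_def\<close>)
  have "?A \<union> ?B = keys c" by auto
  then have "c = (\<Sum>m\<in>?A \<union> ?B. single m (lookup c m))"
    using poly_mapping_sum_single[of c] by simp
  also have "\<dots> = ?c0 + (\<Sum>m\<in>?B. single m (lookup c m))"
    by (rule sum.union_disjoint) auto
  also have "(\<Sum>m\<in>?B. single m (lookup c m)) = Var x * ?c1"
    unfolding Var_def sum_distrib_left mult_single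
    by (intro sum.cong refl) (use shift in auto)
  finally show "c = ?c0 + Var x * ?c1" .
  show "?c0 \<in> polys I"
  proof (intro polys_sum polys_single)
    fix m assume m: "m \<in> ?A"
    then have "x \<notin> keys m" by (simp add: in_keys_iff)
    then show "keys m \<subseteq> I" using keys[of m] m by blast
  qed
  show "?c1 \<in> polys (insert x I)"
  proof (intro polys_sum polys_single)
    fix m assume m: "m \<in> ?B"
    have "keys (m - single x 1) \<subseteq> keys m" by (auto simp: in_keys_iff lookup_minus)
    then show "keys (m - single x 1) \<subseteq> insert x I" using keys[of m] m by blast
  qed
  fix m assume "m \<in> keys ?c1"
  then obtain m' where m': "m' \<in> ?B" "m = m' - single x 1"
    using keys_sum_single[of "\<lambda>m. m - single x 1" "lookup c" ?B] by blast
  then show "\<exists>m'\<in>keys c. lookup m' x = Suc (lookup m x)"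
    by (intro bexI[of _ m']) (auto simp: lookup_minus)
qed

text \<open>This is why the transcendence degree of the quotient drops along strict inclusions of primes.
  In a relation modulo \<open>P\<close> the part without \<open>g\<close> is a relation modulo \<open>Q\<close>, hence zero. So \<open>g\<close> divides the
  relation, and it can be cancelled because \<open>P\<close> is prime; this lowers the degree in \<open>g\<close>.\<close>

lemma independent_mod_Suc:
  fixes P Q :: "('x, 'k::field) mpoly set"
  assumes P: "primeideal P (polynomial_ring X)" and Q: "ideal Q (polynomial_ring X)"
    and PQ: "P \<subseteq> Q" and g: "g \<in> Q" "g \<notin> P" and F: "independent_mod X Q d F"
  shows "independent_mod X P (Suc d) (F(d := g))"
proof -
  let ?G = "F(d := g)"
  have gX: "g \<in> polys X" using g(1) ideal_subset_polys[OF Q] by blast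
  have GX: "?G i \<in> polys X" if "i \<in> {..<Suc d}" for i
    using that gX F by (auto simp: independent_mod_def less_Suc_eq)
  have ind: "c = 0" if "c \<in> polys {..<Suc d}" "\<forall>m\<in>keys c. lookup m d < n" "substitute ?G c \<in> P" for c n
    using that
  proof (induction n arbitrary: c)
    case 0
    then show ?case by (metis not_less0 keys_eq_empty ex_in_conv)
  next
    case (Suc n)
    have "c \<in> polys (insert d {..<d})"
      using Suc.prems(1) by (simp add: lessThan_Suc)
    then obtain c0 c1 where c: "c = c0 + Var d * c1" "c0 \<in> polys {..<d}" "c1 \<in> polys (insert d {..<d})"
      "\<And>m. m \<in> keys c1 \<Longrightarrow> \<exists>m'\<in>keys c. lookup m' d = Suc (lookup m d)"
      by (rule polys_split_variable) blast
    have c1: "c1 \<in> polys {..<Suc d}" using c(3) by (simp add: lessThan_Suc)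
    have c0_eq: "substitute ?G c0 = substitute F c0"
      by (rule substitute_cong) (use c(2) in \<open>auto simp: polys_iff\<close>)
    have split: "substitute ?G c = substitute F c0 + g * substitute ?G c1"
      unfolding c(1) linear_extension_add substitute_mult substitute_Var c0_eq by simp
    have c1X: "substitute ?G c1 \<in> polys X"
      using substitute_in_polys[OF GX c1] .
    have "g * substitute ?G c1 \<in> Q"
      using ideal_mult[OF Q c1X g(1)] by (simp add: mult.commute)
    then have "substitute ?G c - g * substitute ?G c1 \<in> Q"
      using ideal_diff[OF Q] Suc.prems(3) PQ by blast
    then have "substitute F c0 \<in> Q" using split by simp
    then have c0: "c0 = 0" using F c(2) by (simp add: independent_mod_def)
    then have "g * substitute ?G c1 \<in> P" using Suc.prems(3) unfolding split c0 by simp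
    then have "substitute ?G c1 \<in> P"
      using P g(2) gX c1X unfolding primeideal_polynomial_ring_iff by blast
    moreover have "\<forall>m\<in>keys c1. lookup m d < n"
      using c(4) Suc.prems(2) by fastforce
    ultimately have "c1 = 0" using Suc.IH[OF c1] by blast
    then show ?case using c(1) c0 by simp
  qed
  have "c = 0" if c: "c \<in> polys {..<Suc d}" "substitute ?G c \<in> P" for c
  proof (rule ind[OF c(1) _ c(2)])
    show "\<forall>m\<in>keys c. lookup m d < Suc (\<Sum>m\<in>keys c. lookup m d)"
      by (auto simp: less_Suc_eq_le intro: member_le_sum)
  qed
  then show ?thesis
    using GX by (auto simp: independent_mod_def)
qed


section \<open>Counting monomials\<close>

definition exponent_box :: "nat \<Rightarrow> 'x set \<Rightarrow> ('x \<Rightarrow>\<^sub>0 nat) set" where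
  "exponent_box M X = {m. keys m \<subseteq> X \<and> (\<forall>x. lookup m x \<le> M)}"

lemma
  assumes X: "finite X"
  shows finite_exponent_box: "finite (exponent_box M X)"
    and card_exponent_box: "card (exponent_box M X) = Suc M ^ card X"
proof -
  have bij: "bij_betw (\<lambda>m. restrict (lookup m) X) (exponent_box M X) (PiE X (\<lambda>_. {..M}))"
  proof (rule bij_betwI[where g = "\<lambda>f. Abs_poly_mapping (\<lambda>x. if x \<in> X then f x else 0)"])
    show "(\<lambda>m. restrict (lookup m) X) \<in> exponent_box M X \<rightarrow> PiE X (\<lambda>_. {..M})"
      by (auto simp: exponent_box_def)
    have look: "lookup (Abs_poly_mapping (\<lambda>x. if x \<in> X then f x else 0)) x = (if x \<in> X then f x else 0)"
      for f :: "'a \<Rightarrow> nat" and x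
    proof -
      have "finite {x. (if x \<in> X then f x else 0) \<noteq> 0}"
        by (rule finite_subset[OF _ X]) auto
      then show ?thesis by simp
    qed
    show "(\<lambda>f. Abs_poly_mapping (\<lambda>x. if x \<in> X then f x else 0)) \<in> PiE X (\<lambda>_. {..M}) \<rightarrow> exponent_box M X"
      by (auto simp: exponent_box_def in_keys_iff look PiE_iff split: if_splits)
    show "Abs_poly_mapping (\<lambda>x. if x \<in> X then restrict (lookup m) X x else 0) = m"
      if "m \<in> exponent_box M X" for m
      by (rule poly_mapping_eqI)
        (use that in \<open>auto simp: look exponent_box_def in_keys_iff subset_iff\<close>)
    show "restrict (lookup (Abs_poly_mapping (\<lambda>x. if x \<in> X then f x else 0))) X = f"
      if "f \<in> PiE X (\<lambda>_. {..M})" for f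
      using that by (intro ext) (auto simp: look restrict_def PiE_iff extensional_def)
  qed
  have "finite (PiE X (\<lambda>_. {..M}))"
    using X by (intro finite_PiE) auto
  then show "finite (exponent_box M X)"
    using bij bij_betw_finite by blast
  show "card (exponent_box M X) = Suc M ^ card X"
    using bij_betw_same_card[OF bij] card_PiE[OF X, of "\<lambda>_. {..M}"] by simp
qed

lemma exponent_box_add:
  "m \<in> exponent_box M X \<Longrightarrow> m' \<in> exponent_box M' X \<Longrightarrow> m + m' \<in> exponent_box (M + M') X"
  by (auto simp: exponent_box_def keys_add_nat lookup_add intro: add_mono)

lemma exponent_box_mono: "M \<le> M' \<Longrightarrow> exponent_box M X \<subseteq> exponent_box M' X"
  by (auto simp: exponent_box_def intro: order_trans)

lemma keys_mult_exponent_box: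
  assumes "keys p \<subseteq> exponent_box M X" "keys q \<subseteq> exponent_box M' X"
  shows "keys (p * q) \<subseteq> exponent_box (M + M') X"
proof
  fix m assume "m \<in> keys (p * q)"
  then obtain a b where "a \<in> keys p" "b \<in> keys q" "m = a + b"
    using keys_mult[of p q] by blast
  then show "m \<in> exponent_box (M + M') X"
    using assms exponent_box_add by blast
qed

lemma keys_power_exponent_box:
  fixes p :: "('x, 'k::field) mpoly"
  assumes "keys p \<subseteq> exponent_box M X"
  shows "keys (p ^ n) \<subseteq> exponent_box (n * M) X"
proof (induction n)
  case 0
  show ?case by (simp add: exponent_box_def)
next
  case (Suc n)
  then show ?case using keys_mult_exponent_box[OF assms Suc.IH] by simp
qed

lemma keys_prod_exponent_box:
  fixes f :: "'i \<Rightarrow> ('x, 'k::field) mpoly"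
  assumes "\<And>a. a \<in> A \<Longrightarrow> keys (f a) \<subseteq> exponent_box (g a) X"
  shows "keys (prod f A) \<subseteq> exponent_box (sum g A) X"
  using assms
proof (induction A rule: infinite_finite_induct)
  case (insert a A)
  have "keys (f a * prod f A) \<subseteq> exponent_box (g a + sum g A) X"
    by (rule keys_mult_exponent_box) (use insert in auto)
  then show ?case using insert by simp
qed (auto simp: exponent_box_def)

lemma power_bound_contradiction:
  assumes "N < d" "1 \<le> D" "\<And>M. Suc M ^ d \<le> Suc (d * M * D) ^ N"
  shows False
proof -
  \<comment> \<open>For this \<open>M\<close> the bound would give \<open>(M + 1)\<^sup>N (M + 1) \<le> (M + 1)\<^sup>N M\<close>.\<close>
  define M where "M = (d * D) ^ N"
  have d1: "1 \<le> d * D" using assms(1,2) by (cases d; cases D) auto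
  have "Suc M ^ N * Suc M = Suc M ^ Suc N" by simp
  also have "\<dots> \<le> Suc M ^ d" using assms(1) by (intro power_increasing) auto
  also have "\<dots> \<le> Suc (d * M * D) ^ N" by (rule assms(3))
  also have "\<dots> \<le> (d * D * Suc M) ^ N"
    using d1 by (intro power_mono) (simp_all add: algebra_simps)
  also have "\<dots> = Suc M ^ N * M"
    unfolding power_mult_distrib[of "d * D" "Suc M" N] M_def[symmetric] by (rule mult.commute)
  finally show False by simp
qed

text \<open>More than \<open>|X|\<close> polynomials cannot be independent: their \<open>(M + 1)\<^sup>d\<close> power products with
  exponents up to \<open>M\<close> are linearly independent, yet they lie in a space whose dimension grows only like
  \<open>M\<close> to the power \<open>|X|\<close>.\<close>

lemma independent_mod_le_card:
  fixes P :: "('x, 'k::field) mpoly set"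
  assumes X: "finite X" and P: "0 \<in> P" and F: "independent_mod X P d F"
  shows "d \<le> card X"
proof (rule ccontr)
  assume "\<not> ?thesis"
  interpret vs: vector_space "\<lambda>c (p :: ('x, 'k) mpoly). single 0 c * p"
  proof
    fix a b and p q :: "('x, 'k) mpoly"
    show "single 0 a * (p + q) = single 0 a * p + single 0 a * q" by (rule distrib_left)
    show "single 0 (a + b) * p = single 0 a * p + single 0 b * p"
      unfolding single_add by (rule distrib_right)
    show "single 0 a * (single 0 b * p) = single 0 (a * b) * p"
      unfolding mult.assoc[symmetric] mult_single by simp
    show "single 0 1 * p = p" by simp
  qed
  have FX: "keys m \<subseteq> X" if "i < d" "m \<in> keys (F i)" for i m
    using F that by (auto simp: independent_mod_def polys_iff)
  \<comment> \<open>Any bound, at least \<open>1\<close>, for the exponents in all the \<open>F i\<close>.\<close>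
  define D where "D = Suc (\<Sum>i<d. \<Sum>m\<in>keys (F i). \<Sum>x\<in>keys m. lookup m x)"
  have D: "keys (F i) \<subseteq> exponent_box D X" if i: "i < d" for i
  proof
    fix m assume m: "m \<in> keys (F i)"
    have "lookup m x \<le> D" for x
    proof (cases "x \<in> keys m")
      case True
      have "lookup m x \<le> (\<Sum>x\<in>keys m. lookup m x)"
        using True by (intro member_le_sum) auto
      also have "\<dots> \<le> (\<Sum>m\<in>keys (F i). \<Sum>x\<in>keys m. lookup m x)"
        using m by (intro member_le_sum[where f = "\<lambda>m. \<Sum>x\<in>keys m. lookup m x"]) auto
      also have "\<dots> \<le> (\<Sum>i<d. \<Sum>m\<in>keys (F i). \<Sum>x\<in>keys m. lookup m x)"
        using i by (intro member_le_sum[where f = "\<lambda>i. \<Sum>m\<in>keys (F i). \<Sum>x\<in>keys m. lookup m x"]) auto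
      finally show ?thesis by (simp add: D_def)
    qed (simp add: in_keys_iff)
    then show "m \<in> exponent_box D X" using FX[OF i m] by (simp add: exponent_box_def)
  qed
  have ind: "c = 0" if "c \<in> polys {..<d}" "substitute F c = 0" for c
    using that F P by (simp add: independent_mod_def)
  have "Suc M ^ d \<le> Suc (d * M * D) ^ card X" for M
  proof -
    let ?E = "exponent_box M {..<d}" and ?B = "exponent_box (d * M * D) X"
    let ?mon = "\<lambda>m. single m 1 :: ('x, 'k) mpoly"
    have finE: "finite ?E" and finB: "finite ?B"
      using X by (auto intro: finite_exponent_box)
    have E: "single e a \<in> polys {..<d}" if "e \<in> ?E" for e and a :: 'k
      using that by (auto simp: exponent_box_def intro: polys_single)
    have inj: "inj_on (power_product F) ?E"
    proof (rule inj_onI)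
      fix e e' assume e: "e \<in> ?E" "e' \<in> ?E" "power_product F e = power_product F e'"
      have "single e 1 - single e' 1 = (0 :: (nat, 'k) mpoly)"
        by (rule ind) (use e in \<open>auto simp: polys_diff E linear_extension_diff\<close>)
      then show "e = e'" by (simp add: single_one_inject)
    qed
    have "vs.independent (power_product F ` ?E)"
    proof (rule vs.independent_if_scalars_zero)
      fix f x assume f: "(\<Sum>p\<in>power_product F ` ?E. single 0 (f p) * p) = 0"
        and x: "x \<in> power_product F ` ?E"
      let ?c = "\<Sum>e\<in>?E. single e (f (power_product F e))"
      have "substitute F ?c = (\<Sum>e\<in>?E. single 0 (f (power_product F e)) * power_product F e)"
        by (simp add: linear_extension_sum)
      also have "\<dots> = 0" using f by (simp add: sum.reindex[OF inj])
      finally have c: "?c = 0" by (intro ind polys_sum E)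
      obtain e where e: "e \<in> ?E" "x = power_product F e" using x by blast
      have "lookup ?c e = (\<Sum>e'\<in>?E. if e' = e then f (power_product F e) else 0)"
        unfolding lookup_sum by (intro sum.cong refl) (auto simp: lookup_single when_def)
      then show "f x = 0" using c e finE by simp
    qed (use finE in simp)
    moreover have "power_product F ` ?E \<subseteq> vs.span (?mon ` ?B)"
    proof clarify
      fix e assume e: "e \<in> ?E"
      have "keys (power_product F e) \<subseteq> exponent_box (\<Sum>i\<in>keys e. lookup e i * D) X"
        unfolding power_product_def using e
        by (intro keys_prod_exponent_box keys_power_exponent_box D) (auto simp: exponent_box_def)
      also have "(\<Sum>i\<in>keys e. lookup e i * D) \<le> (\<Sum>i\<in>keys e. M * D)"
        using e by (intro sum_mono mult_right_mono) (auto simp: exponent_box_def)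
      also have "\<dots> \<le> d * M * D"
        using e card_mono[of "{..<d}" "keys e"] by (auto simp: exponent_box_def)
      finally have "keys (power_product F e) \<subseteq> ?B"
        using exponent_box_mono by blast
      moreover have eq: "power_product F e =
          (\<Sum>m\<in>keys (power_product F e). single 0 (lookup (power_product F e) m) * ?mon m)"
        using poly_mapping_sum_single[of "power_product F e"] by (simp add: mult_single)
      ultimately show "power_product F e \<in> vs.span (?mon ` ?B)"
        by (subst eq) (intro vs.span_sum vs.span_scale vs.span_base imageI, blast)
    qed
    ultimately have "card (power_product F ` ?E) \<le> card (?mon ` ?B)"
      using vs.independent_span_bound[of "?mon ` ?B"] finB by blast
    then have "card ?E \<le> card ?B"
      using card_image[OF inj] card_image_le[OF finB, of ?mon] by linarith
    then show ?thesis using X by (simp add: card_exponent_box)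
  qed
  moreover have "1 \<le> D" by (simp add: D_def)
  ultimately show False
    using power_bound_contradiction \<open>\<not> d \<le> card X\<close> by (metis not_le)
qed

lemma prime_chain_le:
  fixes Q :: "('x, 'k::field) mpoly set"
  assumes X: "finite X"
    and "prime_chain (polynomial_ring X) n Q" "independent_mod X Q d F"
  shows "d + n \<le> card X"
  using assms(2,3)
proof (induction n arbitrary: Q d F)
  case 0
  have "ideal Q (polynomial_ring X)"
    using prime_chain_primeideal[OF 0(1)] by (rule primeideal.axioms(1))
  from independent_mod_le_card[OF X ideal_zero[OF this] 0(2)] show ?case by simp
next
  case (Suc n)
  obtain P where P: "prime_chain (polynomial_ring X) n P" "P \<subset> Q"
    using Suc.prems(1) by (rule prime_chain_SucE)
  obtain g where g: "g \<in> Q" "g \<notin> P" using P(2) by blast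
  have Q: "ideal Q (polynomial_ring X)"
    using prime_chain_primeideal[OF Suc.prems(1)] by (rule primeideal.axioms(1))
  have "independent_mod X P (Suc d) (F(d := g))"
    using independent_mod_Suc[OF prime_chain_primeideal[OF P(1)] Q _ g Suc.prems(2)] P(2) by blast
  from Suc.IH[OF P(1) this] show ?case by simp
qed

section \<open>Heights of toric ideals\<close>

text \<open>On the variables \<open>x\<^sub>i\<close> and on one variable \<open>y\<^sub>i\<close> per block the monomial map is injective.\<close>

lemma toric_exponent_inject:
  assumes V: "finite V" and r: "\<And>i. i \<in> V \<Longrightarrow> r i \<in> V"
    and m: "keys m \<subseteq> Plus V {i\<in>V. r i = i}" and m': "keys m' \<subseteq> Plus V {i\<in>V. r i = i}"
    and eq: "toric_exponent V r m = toric_exponent V r m'"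
  shows "m = m'"
proof -
  have X: "keys n \<subseteq> Plus V V" if "keys n \<subseteq> Plus V {i\<in>V. r i = i}" for n :: "'a + 'a \<Rightarrow>\<^sub>0 nat"
    using that by blast
  have zero: "lookup n (Inr i) = 0" if "keys n \<subseteq> Plus V {i\<in>V. r i = i}" "r i \<noteq> i"
    for n :: "'a + 'a \<Rightarrow>\<^sub>0 nat" and i
    using that by (auto simp: in_keys_iff subset_iff)
  have top: "lookup (toric_exponent V r n) (Suc (2 * to_nat_on V c)) = lookup n (Inr c)"
    if n: "keys n \<subseteq> Plus V {i\<in>V. r i = i}" and c: "c \<in> V" "r c = c"
    for n :: "'a + 'a \<Rightarrow>\<^sub>0 nat" and c
  proof -
    have "lookup (toric_exponent V r n) (Suc (2 * to_nat_on V c)) = (\<Sum>i\<in>{i\<in>V. r i = c}. lookup n (Inr i))"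
      using lookup_toric_exponent_odd[OF V X[OF n] c(1)] r by blast
    also have "\<dots> = (\<Sum>i\<in>{c}. lookup n (Inr i))"
    proof (rule sum.mono_neutral_right)
      show "\<forall>i\<in>{i\<in>V. r i = c} - {c}. lookup n (Inr i) = 0"
      proof
        fix i assume "i \<in> {i\<in>V. r i = c} - {c}"
        then have "r i \<noteq> i" by auto
        then show "lookup n (Inr i) = 0" by (rule zero[OF n])
      qed
    qed (use V c in auto)
    finally show ?thesis by simp
  qed
  have Inr: "lookup m (Inr i) = lookup m' (Inr i)" if "i \<in> V" for i
  proof (cases "r i = i")
    case True
    then show ?thesis using top[OF m that] top[OF m' that] eq by simp
  next
    case False
    then show ?thesis using zero[OF m] zero[OF m'] by simp
  qed
  have Inl: "lookup m (Inl i) = lookup m' (Inl i)" if "i \<in> V" for i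
    using lookup_toric_exponent_even[OF V X[OF m] that, of r]
      lookup_toric_exponent_even[OF V X[OF m'] that, of r] eq Inr[OF that] by simp
  show ?thesis
  proof (rule poly_mapping_eqI)
    fix x
    show "lookup m x = lookup m' x"
    proof (cases "x \<in> Plus V V")
      case True
      then show ?thesis using Inl Inr by (auto simp: Plus_def)
    next
      case False
      then have "x \<notin> keys m" "x \<notin> keys m'" using X[OF m] X[OF m'] by auto
      then show ?thesis by (simp add: in_keys_iff)
    qed
  qed
qed

lemma Var_power: "Var x ^ n = single (single x n) 1"
  by (induction n) (simp_all add: Var_def mult_single flip: single_add)

lemma prod_single_one: "(\<Prod>a\<in>A. single (f a) 1) = single (\<Sum>a\<in>A. f a) 1"
  by (induction A rule: infinite_finite_induct) (simp_all add: mult_single)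

text \<open>These variables, outside \<open>S\<close>, therefore stay algebraically independent modulo the kernel.\<close>

lemma independent_mod_toric_kernel:
  fixes r :: "'a \<Rightarrow> 'a"
  assumes V: "finite V" and r: "\<And>i. i \<in> V \<Longrightarrow> r i \<in> V"
  shows "\<exists>F. independent_mod (Plus V V) (toric_kernel V (Plus S S) r :: ('a + 'a, 'k::field) mpoly set)
    (card (V - S) + card {i\<in>V - S. r i = i}) F"
proof -
  define Y where "Y = Plus (V - S) {i\<in>V - S. r i = i}"
  define d where "d = card (V - S) + card {i\<in>V - S. r i = i}"
  have "finite Y" "card Y = d"
    using V by (simp_all add: Y_def d_def card_Plus)
  then obtain y where "bij_betw y {0..<d} Y"
    using ex_bij_betw_nat_finite by blast
  then have y: "inj_on y {..<d}" "y ` {..<d} = Y"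
    by (auto simp: bij_betw_def atLeast0LessThan)
  define F :: "nat \<Rightarrow> ('a + 'a, 'k) mpoly" where "F i = Var (y i)" for i
  define u :: "(nat \<Rightarrow>\<^sub>0 nat) \<Rightarrow> ('a + 'a \<Rightarrow>\<^sub>0 nat)"
    where "u e = (\<Sum>i\<in>keys e. single (y i) (lookup e i))" for e
  have YX: "Y \<subseteq> Plus V V" "Y \<subseteq> Plus V {i\<in>V. r i = i}" "Y \<inter> (Plus S S) = {}"
    by (auto simp: Y_def)
  have pp: "power_product F e = single (u e) 1" for e
    by (simp add: power_product_def F_def Var_power prod_single_one u_def)
  have keys_u: "keys (u e) \<subseteq> Y" if "keys e \<subseteq> {..<d}" for e
    using keys_sum_single[of y "lookup e" "keys e"] that y(2) unfolding u_def by blast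
  have lookup_u: "lookup (u e) (y j) = lookup e j" if e: "keys e \<subseteq> {..<d}" and j: "j < d" for e j
  proof -
    have "lookup (u e) (y j) = (\<Sum>i\<in>keys e. if i = j then lookup e j else 0)"
      unfolding u_def lookup_sum
      by (intro sum.cong refl)
        (use e j inj_onD[OF y(1)] in \<open>auto simp: lookup_single when_def subset_iff\<close>)
    then show ?thesis by (simp add: in_keys_iff)
  qed
  have inj: "e = e'" if e: "keys e \<subseteq> {..<d}" "keys e' \<subseteq> {..<d}"
    and eq: "toric_exponent V r (u e) = toric_exponent V r (u e')" for e e'
  proof (rule poly_mapping_eqI)
    fix j
    have "u e = u e'"
      using toric_exponent_inject[OF V r _ _ eq] keys_u[OF e(1)] keys_u[OF e(2)] YX(2) by blast
    moreover have "j \<notin> keys e" "j \<notin> keys e'" if "\<not> j < d"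
      using e that by auto
    ultimately show "lookup e j = lookup e' j"
      using lookup_u[OF e(1), of j] lookup_u[OF e(2), of j]
      by (cases "j < d") (auto simp: in_keys_iff)
  qed
  have "c = 0" if c: "c \<in> polys {..<d}" and K: "substitute F c \<in> toric_kernel V (Plus S S) r" for c
  proof (rule ccontr)
    assume "c \<noteq> 0"
    then obtain e0 where e0: "e0 \<in> keys c" by fastforce
    have ke: "keys e \<subseteq> {..<d}" if "e \<in> keys c" for e
      using c that by (simp add: polys_iff)
    have "substitute F c = (\<Sum>e\<in>keys c. single (u e) (lookup c e))"
      by (simp add: linear_extension_def pp mult_single)
    then have "toric_map V (Plus S S) r (substitute F c) =
        (\<Sum>e\<in>keys c. single 0 (lookup c e) * toric_monomial V (Plus S S) r (u e))"
      by (simp only: linear_extension_sum linear_extension_single)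
    also have "\<dots> = (\<Sum>e\<in>keys c. single (toric_exponent V r (u e)) (lookup c e))"
    proof (intro sum.cong refl)
      fix e assume "e \<in> keys c"
      then have "keys (u e) \<inter> (Plus S S) = {}" using keys_u[OF ke] YX(3) by blast
      then show "single 0 (lookup c e) * toric_monomial V (Plus S S) r (u e) =
          single (toric_exponent V r (u e)) (lookup c e)"
        by (simp add: toric_monomial_def mult_single)
    qed
    finally have "lookup (toric_map V (Plus S S) r (substitute F c)) (toric_exponent V r (u e0)) =
        (\<Sum>e\<in>keys c. lookup (single (toric_exponent V r (u e)) (lookup c e)) (toric_exponent V r (u e0)))"
      by (simp only: lookup_sum)
    also have "\<dots> = (\<Sum>e\<in>keys c. if e = e0 then lookup c e0 else 0)"
      by (intro sum.cong refl)
        (use inj[OF ke ke[OF e0]] in \<open>auto simp: lookup_single when_def\<close>)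
    also have "\<dots> = lookup c e0" using e0 by simp
    finally show False using e0 K by (simp add: toric_kernel_def in_keys_iff)
  qed
  moreover have "F i \<in> polys (Plus V V)" if "i < d" for i
    unfolding F_def using that y(2) YX(1) by (intro Var_in_polys) blast
  ultimately have "independent_mod (Plus V V) (toric_kernel V (Plus S S) r) d F"
    by (simp add: independent_mod_def)
  then show ?thesis unfolding d_def by blast
qed

text \<open>Starting from the discrete partition, whose kernel is zero, each vertex is moved into its block
  in turn. Every move adds a new minor to the kernel.\<close>

lemma prime_chain_merge:
  fixes r :: "'a \<Rightarrow> 'a"
  assumes V: "finite V" and r: "\<And>i. i \<in> V \<Longrightarrow> r i \<in> V" "\<And>i. i \<in> V \<Longrightarrow> r (r i) = r i"
  shows "prime_chain (polynomial_ring (Plus V V)) (card {i\<in>V. r i \<noteq> i})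
    (toric_kernel V {} r :: ('a + 'a, 'k::field) mpoly set)"
proof -
  define rt where "rt T i = (if i \<in> V - T then i else r i)" for T i
  let ?K = "\<lambda>T. toric_kernel V {} (rt T) :: ('a + 'a, 'k) mpoly set"
  have rtV: "rt T i \<in> V" if "i \<in> V" for T i
    using that r by (simp add: rt_def)
  have "prime_chain (polynomial_ring (Plus V V)) (card T) (?K T)" if "T \<subseteq> {i\<in>V. r i \<noteq> i}" for T
  proof -
    have "finite T" using V that by (auto intro: finite_subset)
    then show ?thesis using that
    proof (induction T rule: finite_induct)
      case empty
      show ?case by (simp add: prime_chain_0 primeideal_toric_kernel)
    next
      case (insert w T)
      have w: "w \<in> V" "r w \<noteq> w" "r w \<in> V" "r w \<notin> insert w T"
        using insert r by auto
      have "rt (insert w T) i = rt (insert w T) j"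
        if i: "i \<in> V" and j: "j \<in> V" and eq: "rt T i = rt T j" for i j
      proof -
        have fixed: "rt T x = x" if "x \<in> V" "x \<notin> T" for x T
          using that by (simp add: rt_def)
        have merged: "rt T x = r x" if "x \<in> T \<or> r x = x" for x T
          using that by (auto simp: rt_def)
        have root: "rt (insert w T) x = r y" if "x \<in> V" "x \<notin> T" "y \<in> V" "y \<in> T" "rt T x = rt T y" for x y
        proof -
          have x: "x = r y" using that fixed[of x T] merged[of y T] by simp
          show ?thesis unfolding x using r(2)[OF that(3)] merged[of "r y" "insert w T"] by simp
        qed
        consider "i \<in> T" "j \<in> T" | "i \<in> T" "j \<notin> T" | "i \<notin> T" "j \<in> T" | "i \<notin> T" "j \<notin> T" by blast
        then show ?thesis
        proof cases
          case 1
          then show ?thesis using eq merged by simp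
        next
          case 2
          then show ?thesis using root[OF j _ i _ eq[symmetric]] merged[of i "insert w T"] by simp
        next
          case 3
          then show ?thesis using root[OF i _ j _ eq] merged[of j "insert w T"] by simp
        next
          case 4
          then show ?thesis using eq fixed[OF i, of T] fixed[OF j, of T] by simp
        qed
      qed
      note coarser = this
      have iso: "isolated_in V {} (rt T)" for T
        by (simp add: isolated_in_def)
      have "?K T \<subseteq> ?K (insert w T)"
      proof (rule toric_kernel_subset[OF V rtV ideal_toric_kernel])
        fix i j assume "i \<in> V" "j \<in> V" "rt T i = rt T j"
        then show "minor i j \<in> ?K (insert w T)"
          by (intro minor_in_toric_kernel[OF iso] coarser)
      qed simp_all
      moreover have "minor w (r w) \<in> ?K (insert w T)"
        using w(1,3) r(2)[OF w(1)] by (intro minor_in_toric_kernel[OF iso]) (simp_all add: rt_def)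
      moreover have "minor w (r w) \<notin> ?K T"
        using w insert.hyps(2) r(2)[OF w(1)]
        by (intro minor_notin_toric_kernel[OF V]) (simp_all add: rt_def)
      ultimately have "?K T \<subset> ?K (insert w T)" by blast
      then show ?case
        using prime_chain_Suc[OF _ _ primeideal_toric_kernel] insert by simp
    qed
  qed
  from this[OF subset_refl] have "prime_chain (polynomial_ring (Plus V V)) (card {i\<in>V. r i \<noteq> i})
    (?K {i\<in>V. r i \<noteq> i})" .
  moreover have "rt {i\<in>V. r i \<noteq> i} = r"
    by (rule ext) (simp add: rt_def)
  ultimately show ?thesis by (simp only:)
qed

text \<open>The lower bound comes from merging the blocks and then killing the variables of \<open>S\<close> one at a
  time. It is attained because the \<open>2|V|\<close> variables leave no room for a longer chain besides the
  independent elements found above.\<close>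

lemma height_toric_kernel:
  fixes r :: "'a \<Rightarrow> 'a"
  assumes V: "finite V" and S: "S \<subseteq> V"
    and r: "\<And>i. i \<in> V \<Longrightarrow> r i \<in> V" "\<And>i. i \<in> V \<Longrightarrow> r (r i) = r i"
    and iso: "isolated_in V (Plus S S) r"
  shows "height (polynomial_ring (Plus V V)) (toric_kernel V (Plus S S) r :: ('a + 'a, 'k::field) mpoly set) =
    enat (card {i\<in>V. r i \<noteq> i} + 2 * card S)"
proof (rule height_eqI)
  let ?R = "polynomial_ring (Plus V V) :: ('a + 'a, 'k) mpoly ring"
  let ?K = "\<lambda>Z. toric_kernel V Z r :: ('a + 'a, 'k) mpoly set"
  let ?n = "card {i\<in>V. r i \<noteq> i}"
  have finS: "finite (Plus S S)" using V S finite_subset by auto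
  have iso_sub: "isolated_in V Z r" if "Z \<subseteq> Plus S S" for Z
    using iso that unfolding isolated_in_def by blast
  have "prime_chain ?R (?n + card Z) (?K Z)" if "Z \<subseteq> Plus S S" for Z
    using finite_subset[OF that finS] that
  proof (induction Z rule: finite_induct)
    case empty
    show ?case using prime_chain_merge[OF V r] by simp
  next
    case (insert z Z)
    have "z \<in> Plus S S" using insert.prems by simp
    then have zV: "z \<in> Plus V V" using S by (cases z) auto
    have "?K Z \<subseteq> ?K (insert z Z)"
    proof (rule toric_kernel_subset[OF V r(1) ideal_toric_kernel])
      show "Var x \<in> ?K (insert z Z)" if "x \<in> Z" "x \<in> Plus V V" for x
        using that by (simp add: Var_in_toric_kernel_iff)
      show "minor i j \<in> ?K (insert z Z)" if "i \<in> V" "j \<in> V" "r i = r j" for i j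
        by (rule minor_in_toric_kernel[OF iso_sub[OF insert.prems] that])
    qed
    moreover have "Var z \<in> ?K (insert z Z)" "Var z \<notin> ?K Z"
      using zV insert.hyps by (simp_all add: Var_in_toric_kernel_iff)
    ultimately have "?K Z \<subset> ?K (insert z Z)" by blast
    then show ?case
      using prime_chain_Suc[OF _ _ primeideal_toric_kernel] insert by simp
  qed
  from this[of "Plus S S"] show chain: "prime_chain ?R (?n + 2 * card S) (?K (Plus S S))"
    using finite_subset[OF S V] by (simp add: card_Plus mult_2)
  fix k assume k: "prime_chain ?R k (?K (Plus S S))"
  obtain F where "independent_mod (Plus V V) (?K (Plus S S)) (card (V - S) + card {i\<in>V - S. r i = i}) F"
    using independent_mod_toric_kernel[of V r S, OF V r(1)] by blast
  from prime_chain_le[OF _ k this]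
  have le: "card (V - S) + card {i\<in>V - S. r i = i} + k \<le> 2 * card V"
    using V by (simp add: card_Plus)
  have rS: "r s = s" if "s \<in> S" for s
  proof -
    have "r s \<in> V" "r (r s) = r s" using that S r by auto
    then show ?thesis using iso that S unfolding isolated_in_def by blast
  qed
  have "V - S = {i\<in>V - S. r i = i} \<union> {i\<in>V. r i \<noteq> i}"
    using rS by auto
  then have "card (V - S) = card ({i\<in>V - S. r i = i} \<union> {i\<in>V. r i \<noteq> i})"
    by (rule arg_cong)
  also have "\<dots> = card {i\<in>V - S. r i = i} + ?n"
    using V by (intro card_Un_disjoint) auto
  finally have "card (V - S) = card {i\<in>V - S. r i = i} + ?n" .
  moreover have "card (V - S) + card S = card V"
    using V S card_Diff_subset[of S V] card_mono[of V S] finite_subset[of S V] by simp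
  ultimately show "k \<le> ?n + 2 * card S" using le by linarith
qed

section \<open>Minimal primes of binomial edge ideals\<close>

text \<open>Vertices in \<open>S\<close> represent themselves, so each of them is a block of its own.\<close>

definition component_rep :: "'a ugraph \<Rightarrow> 'a set \<Rightarrow> 'a \<Rightarrow> 'a" where
  "component_rep G S i =
     (if i \<in> verts G - S then SOME j. (i, j) \<in> connected_in (G \<setminus>\<setminus> S) else i)"

text \<open>The prime \<open>P\<^sub>S(G)\<close> generated by the variables of \<open>S\<close> and the minors of the components of
  \<open>G \<setminus> S\<close>.\<close>

definition cut_prime :: "'a ugraph \<Rightarrow> 'a set \<Rightarrow> ('a + 'a, 'k::field) mpoly set" where
  "cut_prime G S = toric_kernel (verts G) (Plus S S) (component_rep G S)"

lemma component_rep_connected: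
  assumes "i \<in> verts G - S"
  shows "(i, component_rep G S i) \<in> connected_in (G \<setminus>\<setminus> S)"
proof -
  have "(i, i) \<in> connected_in (G \<setminus>\<setminus> S)" using assms by (intro connected_in_refl) simp
  from someI[of "\<lambda>j. (i, j) \<in> connected_in (G \<setminus>\<setminus> S)", OF this]
  show ?thesis using assms by (simp add: component_rep_def)
qed

lemma component_rep_outside: "i \<notin> verts G - S \<Longrightarrow> component_rep G S i = i"
  unfolding component_rep_def by (rule if_not_P)

lemma component_rep_in_verts_diff: "i \<in> verts G - S \<Longrightarrow> component_rep G S i \<in> verts G - S"
  using connected_in_verts(2)[OF component_rep_connected] by simp

lemma component_rep_in_verts: "i \<in> verts G \<Longrightarrow> component_rep G S i \<in> verts G"
  using component_rep_in_verts_diff[of i G S] component_rep_outside[of i G S]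
  by (cases "i \<in> verts G - S") auto

lemma component_rep_eq_iff:
  assumes i: "i \<in> verts G - S" and j: "j \<in> verts G - S"
  shows "component_rep G S i = component_rep G S j \<longleftrightarrow> (i, j) \<in> connected_in (G \<setminus>\<setminus> S)"
proof
  assume eq: "component_rep G S i = component_rep G S j"
  show "(i, j) \<in> connected_in (G \<setminus>\<setminus> S)"
    using component_rep_connected[OF i] connected_in_sym[OF component_rep_connected[OF j]]
    unfolding eq by (rule connected_in_trans)
next
  assume ij: "(i, j) \<in> connected_in (G \<setminus>\<setminus> S)"
  have "(i, k) \<in> connected_in (G \<setminus>\<setminus> S) \<longleftrightarrow> (j, k) \<in> connected_in (G \<setminus>\<setminus> S)" for k
    using connected_in_trans[OF ij, of k] connected_in_trans[OF connected_in_sym[OF ij], of k] by blast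
  then show "component_rep G S i = component_rep G S j"
    unfolding component_rep_def using i j by simp
qed

lemma component_rep_idem:
  "component_rep G S (component_rep G S i) = component_rep G S i"
proof (cases "i \<in> verts G - S")
  case True
  show ?thesis
    unfolding component_rep_eq_iff[OF component_rep_in_verts_diff[OF True] True]
    by (rule connected_in_sym[OF component_rep_connected[OF True]])
next
  case False
  from component_rep_outside[OF this] show ?thesis by simp
qed

lemma isolated_in_component_rep: "isolated_in (verts G) (Plus S S) (component_rep G S)"
  unfolding isolated_in_def
proof (intro ballI impI)
  fix i j assume "i \<in> verts G" "Inl i \<in> Plus S S \<or> Inr i \<in> Plus S S" "j \<in> verts G"
    and eq: "component_rep G S j = component_rep G S i"
  then have i: "i \<in> S" by auto
  then have "component_rep G S j = i" using eq component_rep_outside[of i G S] by simp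
  then show "j = i"
    using i component_rep_in_verts_diff[of j G S] component_rep_outside[of j G S]
    by (cases "j \<in> verts G - S") auto
qed

lemma card_component_rep_fixed:
  "card {i\<in>verts G - S. component_rep G S i = i} = num_comp_del G S"
proof -
  let ?C = "connected_in (G \<setminus>\<setminus> S)"
  note equiv = equiv_connected_in[of "G \<setminus>\<setminus> S"]
  have "bij_betw (\<lambda>i. ?C `` {i}) {i\<in>verts G - S. component_rep G S i = i} (components (G \<setminus>\<setminus> S))"
    unfolding bij_betw_def
  proof (intro conjI inj_onI subset_antisym)
    fix i j assume i: "i \<in> {i\<in>verts G - S. component_rep G S i = i}"
      and j: "j \<in> {i\<in>verts G - S. component_rep G S i = i}" and eq: "?C `` {i} = ?C `` {j}"
    have "j \<in> verts (G \<setminus>\<setminus> S)" using j by simp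
    from eq_equiv_class[OF eq equiv this] show "i = j"
      using component_rep_eq_iff[of i G S j] i j by simp
  next
    show "(\<lambda>i. ?C `` {i}) ` {i\<in>verts G - S. component_rep G S i = i} \<subseteq> components (G \<setminus>\<setminus> S)"
      unfolding components_def by (auto intro: quotientI)
    show "components (G \<setminus>\<setminus> S) \<subseteq> (\<lambda>i. ?C `` {i}) ` {i\<in>verts G - S. component_rep G S i = i}"
    proof
      fix C assume "C \<in> components (G \<setminus>\<setminus> S)"
      then obtain i where i: "i \<in> verts G - S" "C = ?C `` {i}"
        unfolding components_def quotient_def by auto
      show "C \<in> (\<lambda>i. ?C `` {i}) ` {i\<in>verts G - S. component_rep G S i = i}"
      proof (rule image_eqI)
        show "C = ?C `` {component_rep G S i}"
          unfolding i(2) by (rule equiv_class_eq[OF equiv component_rep_connected[OF i(1)]])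
        show "component_rep G S i \<in> {i\<in>verts G - S. component_rep G S i = i}"
          using component_rep_in_verts_diff[OF i(1)] component_rep_idem[of G S i] by simp
      qed
    qed
  qed
  then show ?thesis
    unfolding num_comp_del_def by (rule bij_betw_same_card)
qed

text \<open>The vertices outside \<open>S\<close>, except for one representative per component, are merged into their
  blocks, and two variables are killed for each vertex in \<open>S\<close>: the height is
  \<open>(n - |S| - c\<^sub>G(S)) + 2|S|\<close>, written below without subtraction of natural numbers.\<close>

lemma height_cut_prime:
  assumes G: "simple_graph G" and S: "S \<subseteq> verts G"
  obtains h where "height (bei_ring G) (cut_prime G S :: ('a + 'a, 'k::field) mpoly set) = enat h"
    "h + num_comp_del G S = card (verts G) + card S"
proof
  let ?r = "component_rep G S" and ?V = "verts G"
  have V: "finite ?V" by (rule simple_graph_finite[OF G])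
  let ?h = "card {i\<in>?V. ?r i \<noteq> i} + 2 * card S"
  show "height (bei_ring G) (cut_prime G S :: ('a + 'a, 'k) mpoly set) = enat ?h"
    unfolding bei_ring_def cut_prime_def
    by (rule height_toric_kernel[OF V S component_rep_in_verts component_rep_idem
          isolated_in_component_rep])
  have "V - S = {i\<in>V - S. r i = i} \<union> {i\<in>V. r i \<noteq> i}" if "\<And>s. s \<in> S \<Longrightarrow> r s = s"
    for V :: "'a set" and r
    using that by auto
  from this[of ?r ?V] have "card (?V - S) = card ({i\<in>?V - S. ?r i = i} \<union> {i\<in>?V. ?r i \<noteq> i})"
    by (rule arg_cong) (simp add: component_rep_outside)
  also have "\<dots> = num_comp_del G S + card {i\<in>?V. ?r i \<noteq> i}"
    unfolding card_component_rep_fixed[symmetric] using V by (intro card_Un_disjoint) auto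
  finally have "card (?V - S) = num_comp_del G S + card {i\<in>?V. ?r i \<noteq> i}" .
  moreover have "card (?V - S) + card S = card ?V"
    using V S card_Diff_subset[of S ?V] card_mono[of ?V S] finite_subset[of S ?V] by simp
  ultimately show "?h + num_comp_del G S = card ?V + card S" by linarith
qed

lemma primeideal_cut_prime: "primeideal (cut_prime G S) (bei_ring G)"
  unfolding cut_prime_def bei_ring_def by (rule primeideal_toric_kernel)

lemma ideal_cut_prime: "ideal (cut_prime G S) (bei_ring G)"
  unfolding cut_prime_def bei_ring_def by (rule ideal_toric_kernel)

lemma binomial_edge_ideal_subset_iff:
  fixes Q :: "('a + 'a, 'k::field) mpoly set"
  assumes G: "simple_graph G" and Q: "ideal Q (bei_ring G)"
  shows "binomial_edge_ideal G \<subseteq> Q \<longleftrightarrow> (\<forall>i j. {i, j} \<in> edges G \<longrightarrow> minor i j \<in> Q)"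
proof -
  let ?R = "bei_ring G :: ('a + 'a, 'k) mpoly ring"
  let ?B = "{minor i j | i j. {i, j} \<in> edges G} :: ('a + 'a, 'k) mpoly set"
  interpret cring ?R unfolding bei_ring_def by (rule cring_polynomial_ring)
  have I: "binomial_edge_ideal G = Idl\<^bsub>?R\<^esub> ?B"
    by (simp add: binomial_edge_ideal_def minor_def)
  have "?B \<subseteq> carrier ?R"
    unfolding bei_ring_def
  proof clarify
    fix i j assume "{i, j} \<in> edges G"
    note simple_graph_edgeD(1,2)[OF G this]
    then show "minor i j \<in> polys (Plus (verts G) (verts G))" by (rule minor_in_polys)
  qed
  from genideal_self[OF this] have "?B \<subseteq> binomial_edge_ideal G" unfolding I .
  then have "binomial_edge_ideal G \<subseteq> Q \<longleftrightarrow> ?B \<subseteq> Q"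
    using genideal_minimal[OF Q, of ?B] unfolding I by (auto intro: subset_trans)
  then show ?thesis by blast
qed

lemma minor_in_ideal_if_Var:
  fixes Q :: "('a + 'a, 'k::field) mpoly set"
  assumes Q: "ideal Q (polynomial_ring (Plus V V))" and V: "i \<in> V" "j \<in> V"
    and vars: "Var (Inl i) \<in> Q" "Var (Inr i) \<in> Q"
  shows "minor i j \<in> Q" "minor j i \<in> Q"
proof -
  have "Var (Inr j) * Var (Inl i) \<in> Q" "Var (Inl j) * Var (Inr i) \<in> Q"
    using V ideal_mult[OF Q Var_in_polys vars(1)] ideal_mult[OF Q Var_in_polys vars(2)] by simp_all
  then show "minor i j \<in> Q" "minor j i \<in> Q"
    unfolding minor_def by (auto intro: ideal_diff[OF Q] simp: mult.commute)
qed

lemma binomial_edge_ideal_subset_cut_prime: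
  assumes G: "simple_graph G"
  shows "binomial_edge_ideal G \<subseteq> (cut_prime G S :: ('a + 'a, 'k::field) mpoly set)"
  unfolding binomial_edge_ideal_subset_iff[OF G ideal_cut_prime]
proof (intro allI impI)
  fix i j assume e: "{i, j} \<in> edges G"
  note V = simple_graph_edgeD(1,2)[OF G e]
  let ?K = "cut_prime G S :: ('a + 'a, 'k) mpoly set"
  have K: "ideal ?K (polynomial_ring (Plus (verts G) (verts G)))"
    unfolding cut_prime_def by (rule ideal_toric_kernel)
  have Var: "Var (Inl k) \<in> ?K" "Var (Inr k) \<in> ?K" if "k \<in> S" "k \<in> verts G" for k
    using that unfolding cut_prime_def by (simp_all add: Var_in_toric_kernel_iff)
  consider "i \<in> S" | "j \<in> S" | "i \<notin> S" "j \<notin> S" by blast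
  then show "minor i j \<in> ?K"
  proof cases
    case 1
    then show ?thesis using minor_in_ideal_if_Var(1)[OF K V Var[OF 1 V(1)]] by blast
  next
    case 2
    then show ?thesis using minor_in_ideal_if_Var(2)[OF K V(2,1) Var[OF 2 V(2)]] by blast
  next
    case 3
    then have "(i, j) \<in> connected_in (G \<setminus>\<setminus> S)"
      using e V by (intro connected_in_edge) auto
    then show ?thesis
      unfolding cut_prime_def using 3 V
      by (intro minor_in_toric_kernel isolated_in_component_rep) (simp_all add: component_rep_eq_iff)
  qed
qed

text \<open>Modulo a prime, being parallel is transitive for vectors \<open>(x\<^sub>i, y\<^sub>i)\<close> as long as the middle one
  does not vanish.\<close>

lemma minor_trans_in_prime:
  fixes Q :: "('a + 'a, 'k::field) mpoly set"
  assumes Q: "primeideal Q (polynomial_ring (Plus V V))" and V: "i \<in> V" "j \<in> V" "k \<in> V"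
    and ij: "minor i j \<in> Q" and jk: "minor j k \<in> Q"
    and j: "Var (Inl j) \<notin> Q \<or> Var (Inr j) \<notin> Q"
  shows "minor i k \<in> Q"
proof -
  note I = primeideal.axioms(1)[OF Q]
  have X: "(Var (Inl a) :: ('a + 'a, 'k) mpoly) \<in> polys (Plus V V)"
    "(Var (Inr a) :: ('a + 'a, 'k) mpoly) \<in> polys (Plus V V)" if "a \<in> V" for a
    using that by (simp_all add: Var_in_polys)
  have "Var (Inl j) * minor i k = Var (Inl i) * minor j k + Var (Inl k) * (minor i j :: ('a + 'a, 'k) mpoly)"
    "Var (Inr j) * minor i k = Var (Inr i) * minor j k + Var (Inr k) * (minor i j :: ('a + 'a, 'k) mpoly)"
    by (simp_all add: minor_def algebra_simps)
  moreover have "p * minor j k + q * minor i j \<in> Q" if "p \<in> polys (Plus V V)" "q \<in> polys (Plus V V)" for p q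
    using that by (intro ideal_add[OF I] ideal_mult[OF I] ij jk)
  ultimately have "Var (Inl j) * minor i k \<in> Q" "Var (Inr j) * minor i k \<in> Q"
    using X V by simp_all
  then show ?thesis
    using Q j X V minor_in_polys[OF V(1,3)] unfolding primeideal_polynomial_ring_iff by blast
qed

text \<open>Modulo \<open>Q\<close> adjacent vertices have parallel vectors \<open>(x\<^sub>i, y\<^sub>i)\<close>. Away from the set \<open>T\<close> of
  vertices whose vector vanishes this spreads along the walks of \<open>G \<setminus> T\<close>.\<close>

lemma cut_prime_subset_prime:
  fixes Q :: "('a + 'a, 'k::field) mpoly set"
  assumes G: "simple_graph G" and Q: "primeideal Q (bei_ring G)"
    and sub: "binomial_edge_ideal G \<subseteq> Q"
  defines "T \<equiv> {i \<in> verts G. Var (Inl i) \<in> Q \<and> Var (Inr i) \<in> Q}"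
  shows "cut_prime G T \<subseteq> Q"
  unfolding cut_prime_def
proof (rule toric_kernel_subset)
  let ?V = "verts G"
  show "finite ?V" by (rule simple_graph_finite[OF G])
  show "\<And>i. i \<in> ?V \<Longrightarrow> component_rep G T i \<in> ?V" by (rule component_rep_in_verts)
  note Q' = Q[unfolded bei_ring_def]
  show I: "ideal Q (polynomial_ring (Plus ?V ?V))"
    by (rule primeideal.axioms(1)[OF Q'])
  show "\<And>x. x \<in> Plus T T \<Longrightarrow> Var x \<in> Q" by (auto simp: T_def)
  fix i j assume i: "i \<in> ?V" and j: "j \<in> ?V" and eq: "component_rep G T i = component_rep G T j"
  show "minor i j \<in> Q"
  proof (cases "i \<in> T \<or> j \<in> T")
    case True
    then have "i = j"
      using isolated_in_component_rep[of G T] i j eq unfolding isolated_in_def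
      by (metis InlI)
    then show ?thesis using ideal_zero[OF I] by simp
  next
    case False
    then have "(i, j) \<in> connected_in (G \<setminus>\<setminus> T)"
      using component_rep_eq_iff[of i G T j] i j eq by simp
    then show ?thesis
    proof (induction rule: connected_in_induct)
      case refl
      show ?case using ideal_zero[OF I] by simp
    next
      case (edge y z)
      have e: "{y, z} \<in> edges G" "y \<in> ?V" "z \<in> ?V" "y \<notin> T"
        using edge.hyps by auto
      have "minor y z \<in> Q"
        using sub e(1) binomial_edge_ideal_subset_iff[OF G primeideal.axioms(1)[OF Q]] by blast
      then show ?case
        using e by (intro minor_trans_in_prime[OF Q' i e(2,3) edge.IH]) (auto simp: T_def)
    qed
  qed
qed

text \<open>A variable lies in \<open>P\<^sub>S(G)\<close> only if its vertex is in \<open>S\<close>, and a minor of two vertices outside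
  \<open>S\<close> only if they are in the same component; so inclusion can be read off from the generators.\<close>

lemma cut_prime_subset_cut_prime_iff:
  assumes G: "simple_graph G" and T: "T \<subseteq> verts G" and S: "S \<subseteq> verts G"
  shows "(cut_prime G T :: ('a + 'a, 'k::field) mpoly set) \<subseteq> cut_prime G S \<longleftrightarrow> T \<subseteq> S \<and>
    (\<forall>i\<in>verts G - S. \<forall>j\<in>verts G - S.
       (i, j) \<in> connected_in (G \<setminus>\<setminus> T) \<longrightarrow> (i, j) \<in> connected_in (G \<setminus>\<setminus> S))"
    (is "?sub \<longleftrightarrow> _ \<and> ?conn")
proof (intro iffI conjI)
  let ?V = "verts G"
  let ?K = "\<lambda>S. cut_prime G S :: ('a + 'a, 'k) mpoly set"
  have V: "finite ?V" by (rule simple_graph_finite[OF G])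
  have Var: "Var x \<in> ?K S \<longleftrightarrow> x \<in> Plus S S" if "x \<in> Plus ?V ?V" for x S
    unfolding cut_prime_def by (rule Var_in_toric_kernel_iff[OF that])
  {
    assume sub: ?sub
    show TS: "T \<subseteq> S"
    proof
      fix t assume t: "t \<in> T"
      then have "Var (Inl t) \<in> ?K T" using T Var[of "Inl t" T] by blast
      then have "Var (Inl t) \<in> ?K S" using sub by blast
      then show "t \<in> S" using Var[of "Inl t" S] t T by blast
    qed
    show ?conn
    proof (intro ballI impI)
      fix i j assume i: "i \<in> ?V - S" and j: "j \<in> ?V - S" and ij: "(i, j) \<in> connected_in (G \<setminus>\<setminus> T)"
      have iT: "i \<in> ?V - T" "j \<in> ?V - T" using i j TS by auto
      have "minor i j \<in> ?K T"
        unfolding cut_prime_def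
        by (rule minor_in_toric_kernel[OF isolated_in_component_rep])
          (use iT ij component_rep_eq_iff[OF iT] in auto)
      from subsetD[OF sub this] have minor: "minor i j \<in> ?K S" .
      have "component_rep G S i = component_rep G S j"
      proof (rule ccontr)
        assume "component_rep G S i \<noteq> component_rep G S j"
        then have "minor i j \<notin> ?K S"
          unfolding cut_prime_def using i j
          by (intro minor_notin_toric_kernel[OF V] component_rep_in_verts) simp_all
        then show False using minor by contradiction
      qed
      then show "(i, j) \<in> connected_in (G \<setminus>\<setminus> S)"
        using component_rep_eq_iff[OF i j] by simp
    qed
  }
  assume TS: "T \<subseteq> S \<and> ?conn"
  have K: "ideal (?K S) (polynomial_ring (Plus ?V ?V))"
    unfolding cut_prime_def by (rule ideal_toric_kernel)
  show ?sub
    unfolding cut_prime_def[of G T]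
  proof (rule toric_kernel_subset[OF V component_rep_in_verts K])
    fix x assume "x \<in> Plus T T" "x \<in> Plus ?V ?V"
    then have "x \<in> Plus S S" using TS by (cases x) auto
    then show "Var x \<in> ?K S" using Var[of x S] \<open>x \<in> Plus ?V ?V\<close> by simp
  next
    fix i j assume i: "i \<in> ?V" and j: "j \<in> ?V" and eq: "component_rep G T i = component_rep G T j"
    consider "i \<in> S" | "j \<in> S" | "i \<in> ?V - S" "j \<in> ?V - S" using i j by blast
    then show "minor i j \<in> ?K S"
    proof cases
      case 1
      then show ?thesis using i by (intro minor_in_ideal_if_Var(1)[OF K i j]) (simp_all add: Var)
    next
      case 2
      then show ?thesis using j by (intro minor_in_ideal_if_Var(2)[OF K j i]) (simp_all add: Var)
    next
      case 3
      then have "(i, j) \<in> connected_in (G \<setminus>\<setminus> T)"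
        using TS component_rep_eq_iff[of i G T j] eq by blast
      then have "component_rep G S i = component_rep G S j"
        using component_rep_eq_iff[OF 3] TS 3 by blast
      then show ?thesis
        unfolding cut_prime_def by (rule minor_in_toric_kernel[OF isolated_in_component_rep i j])
    qed
  qed
qed

text \<open>Every prime around \<open>J\<^sub>G\<close> contains some \<open>P\<^sub>T(G)\<close>, so only these can be minimal. If a vertex
  \<open>s \<in> T\<close> does not join components of \<open>G \<setminus> T\<close>, then dropping it gives the smaller prime \<open>P\<^bsub>T - {s}\<^esub>(G)\<close>. If
  all vertices of \<open>S\<close> join components, then no smaller \<open>T\<close> gives \<open>P\<^sub>T(G) \<subseteq> P\<^sub>S(G)\<close>, because a vertex of \<open>S - T\<close>
  connects two components of \<open>G \<setminus> S\<close> in \<open>G \<setminus> T\<close>.\<close>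

lemma minimal_prime_binomial_edge_ideal_iff:
  fixes P :: "('a + 'a, 'k::field) mpoly set"
  assumes G: "simple_graph G"
  shows "minimal_prime (bei_ring G) (binomial_edge_ideal G) P \<longleftrightarrow> (\<exists>S\<in>cut_sets G. P = cut_prime G S)"
proof
  assume P: "minimal_prime (bei_ring G) (binomial_edge_ideal G) P"
  define T where "T = {i \<in> verts G. Var (Inl i) \<in> P \<and> Var (Inr i) \<in> P}"
  have T: "T \<subseteq> verts G" by (auto simp: T_def)
  have min: "P = Q" if "Q \<subseteq> P" "primeideal Q (bei_ring G)" "binomial_edge_ideal G \<subseteq> Q" for Q
    using P that unfolding minimal_prime_def by blast
  have "cut_prime G T \<subseteq> P"
    using P unfolding T_def minimal_prime_def by (intro cut_prime_subset_prime[OF G]) auto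
  from min[OF this primeideal_cut_prime binomial_edge_ideal_subset_cut_prime[OF G]]
  have PT: "P = cut_prime G T" .
  have "T \<in> cut_sets G"
  proof (rule ccontr)
    assume "T \<notin> cut_sets G"
    then obtain s where s: "s \<in> T" and N: "\<And>a b. \<lbrakk>a \<in> neighbours G s - T; b \<in> neighbours G s - T\<rbrakk>
        \<Longrightarrow> (a, b) \<in> connected_in (G \<setminus>\<setminus> T)"
      using T unfolding cut_sets_iff_separates_neighbours[OF G] by blast
    let ?T = "T - {s}"
    have sT: "s \<in> verts G" "s \<notin> ?T" using s T by auto
    have Ts: "G \<setminus>\<setminus> ?T \<setminus>\<setminus> {s} = G \<setminus>\<setminus> T"
      using s by (simp add: delete_verts_delete_verts insert_absorb)
    have Ns: "neighbours (G \<setminus>\<setminus> ?T) s \<subseteq> neighbours G s - T"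
      using neighbours_delete_verts[OF G sT] neighboursD(3)[OF G, of _ s] by blast
    have "(i, j) \<in> connected_in (G \<setminus>\<setminus> T)"
      if "i \<in> verts G - T" "j \<in> verts G - T" "(i, j) \<in> connected_in (G \<setminus>\<setminus> ?T)" for i j
      using connected_in_delete_if_neighbours_connected[OF simple_graph_delete_verts[OF G], of ?T s i j]
        that s N Ns unfolding Ts by blast
    then have "cut_prime G ?T \<subseteq> P"
      unfolding PT using T by (subst cut_prime_subset_cut_prime_iff[OF G]) auto
    from min[OF this primeideal_cut_prime binomial_edge_ideal_subset_cut_prime[OF G]]
    have "P = cut_prime G ?T" .
    moreover have "Var (Inl s) \<in> P" using s by (simp add: T_def)
    ultimately show False
      using sT unfolding cut_prime_def by (simp add: Var_in_toric_kernel_iff)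
  qed
  then show "\<exists>S\<in>cut_sets G. P = cut_prime G S" using PT by blast
next
  assume "\<exists>S\<in>cut_sets G. P = cut_prime G S"
  then obtain S where S: "S \<in> cut_sets G" and P: "P = cut_prime G S" by blast
  have SV: "S \<subseteq> verts G" using S by (auto simp: cut_sets_def)
  have "Q = P" if Q: "primeideal Q (bei_ring G)" "binomial_edge_ideal G \<subseteq> Q" "Q \<subseteq> P" for Q
  proof -
    define T where "T = {i \<in> verts G. Var (Inl i) \<in> Q \<and> Var (Inr i) \<in> Q}"
    have TV: "T \<subseteq> verts G" by (auto simp: T_def)
    have TQ: "cut_prime G T \<subseteq> Q"
      unfolding T_def by (rule cut_prime_subset_prime[OF G Q(1,2)])
    then have "cut_prime G T \<subseteq> (cut_prime G S :: ('a + 'a, 'k) mpoly set)"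
      using Q(3) P by blast
    then have TS: "T \<subseteq> S" and conn: "\<And>i j. \<lbrakk>i \<in> verts G - S; j \<in> verts G - S;
        (i, j) \<in> connected_in (G \<setminus>\<setminus> T)\<rbrakk> \<Longrightarrow> (i, j) \<in> connected_in (G \<setminus>\<setminus> S)"
      unfolding cut_prime_subset_cut_prime_iff[OF G TV SV] by blast+
    have "S \<subseteq> T"
    proof (rule ccontr)
      assume "\<not> S \<subseteq> T"
      then obtain s where s: "s \<in> S" "s \<notin> T" by blast
      obtain a b where ab: "a \<in> neighbours G s - S" "b \<in> neighbours G s - S"
        "(a, b) \<notin> connected_in (G \<setminus>\<setminus> S)"
        using S s(1) unfolding cut_sets_iff_separates_neighbours[OF G] by blast
      have sx: "(s, x) \<in> connected_in (G \<setminus>\<setminus> T)" if "x \<in> neighbours G s - S" for x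
        using neighboursD(1,2)[OF G, of x s] that s SV TS by (intro connected_in_edge) auto
      have "(a, b) \<in> connected_in (G \<setminus>\<setminus> T)"
        by (rule connected_in_trans[OF connected_in_sym[OF sx[OF ab(1)]] sx[OF ab(2)]])
      then show False
        using conn[of a b] ab neighboursD(1)[OF G, of _ s] by blast
    qed
    then have "T = S" using TS by blast
    then show "Q = P" using TQ Q(3) P by blast
  qed
  then show "minimal_prime (bei_ring G) (binomial_edge_ideal G) P"
    unfolding minimal_prime_def P
    using primeideal_cut_prime binomial_edge_ideal_subset_cut_prime[OF G] by blast
qed

text \<open>As \<open>P\<^sub>S(G)\<close> has height \<open>n + |S| - c\<^sub>G(S)\<close>, equal heights mean that \<open>c\<^sub>G(S) - |S|\<close> is the same for all
  cut sets, and the empty set is one of them.\<close>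

theorem bei_unmixed_iff_comb_unmixed:
  fixes K :: "'k::field itself"
  assumes G: "simple_graph G"
  shows "bei_unmixed K G \<longleftrightarrow> comb_unmixed G"
proof -
  let ?P = "\<lambda>S. cut_prime G S :: ('a + 'a, 'k) mpoly set"
  let ?R = "bei_ring G :: ('a + 'a, 'k) mpoly ring"
  have "height ?R (?P S) = height ?R (?P T) \<longleftrightarrow>
      num_comp_del G S + card T = num_comp_del G T + card S"
    if S: "S \<in> cut_sets G" and T: "T \<in> cut_sets G" for S T
  proof -
    have SV: "S \<subseteq> verts G" and TV: "T \<subseteq> verts G" using S T by (auto simp: cut_sets_def)
    obtain h where h: "height ?R (?P S) = enat h" "h + num_comp_del G S = card (verts G) + card S"
      by (rule height_cut_prime[OF G SV])
    obtain k where k: "height ?R (?P T) = enat k" "k + num_comp_del G T = card (verts G) + card T"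
      by (rule height_cut_prime[OF G TV])
    show ?thesis unfolding h(1) k(1) using h(2) k(2) by auto
  qed
  then have "bei_unmixed K G \<longleftrightarrow>
      (\<forall>S\<in>cut_sets G. \<forall>T\<in>cut_sets G. num_comp_del G S + card T = num_comp_del G T + card S)"
    unfolding bei_unmixed_def unmixed_def minimal_prime_binomial_edge_ideal_iff[OF G] by blast
  also have "\<dots> \<longleftrightarrow> comb_unmixed G"
    unfolding comb_unmixed_def
  proof (intro iffI ballI)
    fix S
    assume *: "\<forall>S\<in>cut_sets G. \<forall>T\<in>cut_sets G. num_comp_del G S + card T = num_comp_del G T + card S"
      and S: "S \<in> cut_sets G"
    show "num_comp_del G S = card S + num_comp_del G {}"
      using bspec[OF bspec[OF * S] empty_in_cut_sets] by simp
  next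
    fix S T assume *: "\<forall>S\<in>cut_sets G. num_comp_del G S = card S + num_comp_del G {}"
      and ST: "S \<in> cut_sets G" "T \<in> cut_sets G"
    show "num_comp_del G S + card T = num_comp_del G T + card S"
      using bspec[OF * ST(1)] bspec[OF * ST(2)] by linarith
  qed
  finally show ?thesis .
qed

section \<open>Accessibility\<close>

theorem corollary5p16:
  fixes K :: "'k::field itself" and G :: "'a ugraph" and v :: 'a
  assumes "simple_graph G"
    and "accessible K G"
    and "cut_vertex G v"
    and "bei_unmixed K (G \<setminus>\<setminus> {v})"
  shows "accessible K (G \<setminus>\<setminus> {v}) \<and>
         accessible K (complete_nbhd G v) \<and>
         accessible K (complete_nbhd G v \<setminus>\<setminus> {v})"
proof -
  note G = assms(1)
  have U: "comb_unmixed G" and A: "accessible_set_system (cut_sets G)"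
    using assms(2) by (simp_all add: accessible_def bei_unmixed_iff_comb_unmixed[OF G])
  have U_del: "comb_unmixed (G \<setminus>\<setminus> {v})"
    using assms(4) bei_unmixed_iff_comb_unmixed[OF simple_graph_delete_verts[OF G]] by blast
  note facts = G U assms(3) U_del
  have Gv: "simple_graph (complete_nbhd G v)"
    by (rule simple_graph_complete_nbhd[OF G])
  show ?thesis
    unfolding accessible_def
    using assms(4) accessible_delete_cut_vertex[OF facts A]
      accessible_complete_nbhd[OF facts A] accessible_complete_nbhd_delete[OF facts A]
      comb_unmixed_complete_nbhd[OF facts] comb_unmixed_complete_nbhd_delete[OF facts]
      bei_unmixed_iff_comb_unmixed[OF Gv]
      bei_unmixed_iff_comb_unmixed[OF simple_graph_delete_verts[OF Gv]]
    by blast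
qed

end
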